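(* Fix a facet $\mathcal F^{(\ell)}$ of the capacity region $\mathcal C$ and a vector $\boldsymbol r^{(\ell)}$ in the relative interior of $\mathcal F^{(\ell)}$, and consider the family of generalized switches operating under the MaxWeight algorithm, parametrized by $\epsilon\in(0,1)$, described in the context, in which the channel state set has only one element (the channel state is fixed over time). For each $\epsilon$ let $\overline{\boldsymbol q}^{(\epsilon)}$ be a steady-state random vector such that $\{\boldsymbol q^{(\epsilon)}(k):k\ge1\}$ converges in distribution to $\overline{\boldsymbol q}^{(\epsilon)}$, and suppose $\lim_{\epsilon\downarrow0}\mathrm{Cov}[a_i^{(\epsilon)},a_j^{(\epsilon)}]=\mathrm{Cov}[a_i,a_j]$ for all $i,j$ (where $\mathrm{Cov}[a_i,a_j]$ denotes the limit). Then, as $\epsilon\downarrow0$, $\epsilon\overline{\boldsymbol q}^{(\epsilon)}$ converges in distribution to $\overline\Upsilon_2\,\boldsymbol c^{(\ell)}$, where $\overline\Upsilon_2$ is an exponential random variable with mean $$\frac12\sum_{i=1}^n\sum_{j=1}^n c_i^{(\ell)}c_j^{(\ell)}\mathrm{Cov}[a_i,a_j].$$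
   Context: Generalized switch with fixed channel state (ad hoc wireless network): a discrete-time system with $n$ queues. $q_i^{(\epsilon)}(k)$ is the number of jobs in queue $i$ at the beginning of slot $k\ge1$. The arrival vectors $\boldsymbol a^{(\epsilon)}(k)$, $k\ge1$, are i.i.d. over $k$ (components may be correlated), with nonnegative integer components bounded by a finite constant $A_{\max}$ (not depending on $\epsilon$), independent of the queue lengths. $\mathcal S$ is the finite set of feasible service rate vectors (nonnegative vectors). All nonnegative vectors dominated componentwise by a feasible vector are feasible as well, but $\mathcal S$ is taken to contain only the maximal feasible vectors and their projections on the coordinate axes. In slot $k$ the MaxWeight algorithm selects the potential service vector $\boldsymbol s^{(\epsilon)}(k)\in\arg\max_{\boldsymbol x\in\mathcal S}\langle\boldsymbol x,\boldsymbol q^{(\epsilon)}(k)\rangle$, ties broken at random. The dynamics are $q_i^{(\epsilon)}(k+1)=\max\{q_i^{(\epsilon)}(k)+a_i^{(\epsilon)}(k)-s_i^{(\epsilon)}(k),0\}$. The capacity region is $\mathcal C=\mathrm{ConvexHull}(\mathcal S)$, a coordinate convex polytope, described with the minimal number $L$ of half-spaces as $\mathcal C=\{\boldsymbol x\in\mathbb R_+^n:\langle\boldsymbol c^{(\ell)},\boldsymbol x\rangle\le b^{(\ell)},\ \ell=1,\dots,L\}$, where $\boldsymbol c^{(\ell)}\ge\boldsymbol 0$, $\|\boldsymbol c^{(\ell)}\|=1$ (Euclidean norm) and $b^{(\ell)}>0$. The $\ell$-th facet is $\mathcal F^{(\ell)}=\{\boldsymbol x\in\mathcal C:\langle\boldsymbol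 c^{(\ell)},\boldsymbol x\rangle=b^{(\ell)}\}$. Heavy-traffic parametrization: for $\epsilon\in(0,1)$, $E[\boldsymbol a^{(\epsilon)}(k)]=\boldsymbol r^{(\ell)}-\epsilon\boldsymbol c^{(\ell)}$, and $\mathrm{Cov}[a_i^{(\epsilon)},a_j^{(\epsilon)}]$ is the covariance of $a_i^{(\epsilon)}(1)$ and $a_j^{(\epsilon)}(1)$; the service structure does not depend on $\epsilon$. *)

theory Defs
  imports "HOL-Probability.Probability"
begin

section \<open>Convergence in distribution, covariance, exponential law\<close>

text \<open>Weak convergence of Borel laws along a filter; the library's \<^const>\<open>weak_conv_m\<close>
  covers only sequences of laws on the real line.\<close>

definition converges_in_distribution ::
  "('i \<Rightarrow> 'a::topological_space measure) \<Rightarrow> 'a measure \<Rightarrow> 'i filter \<Rightarrow> bool" where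
  "converges_in_distribution \<mu> \<nu> F \<longleftrightarrow>
     (\<forall>f :: 'a \<Rightarrow> real. continuous_on UNIV f \<and> bounded (range f) \<longrightarrow>
        ((\<lambda>i. \<integral>x. f x \<partial>\<mu> i) \<longlongrightarrow> (\<integral>x. f x \<partial>\<nu>)) F)"

definition covariance :: "'w measure \<Rightarrow> ('w \<Rightarrow> real) \<Rightarrow> ('w \<Rightarrow> real) \<Rightarrow> real" where
  "covariance M X Y =
     (\<integral>\<omega>. (X \<omega> - (\<integral>\<omega>'. X \<omega>' \<partial>M)) * (Y \<omega> - (\<integral>\<omega>'. Y \<omega>' \<partial>M)) \<partial>M)"

text \<open>The exponential law, parametrized by its mean. Mean \<open>0\<close> (a limiting covariance may
  vanish) is read as the point mass at \<open>0\<close>.\<close>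

definition exponential_distribution :: "real \<Rightarrow> real measure" where
  "exponential_distribution m =
     (if m = 0 then return borel 0 else density lborel (exponential_density (1 / m)))"


section \<open>Service vectors and capacity region\<close>

definition coord_proj :: "'n set \<Rightarrow> real^'n \<Rightarrow> real^'n" where
  "coord_proj I x = (\<chi> i. if i \<in> I then x $ i else 0)"

definition dominated :: "(real^'n) set \<Rightarrow> (real^'n) set" where
  "dominated S = {y. 0 \<le> y \<and> (\<exists>x\<in>S. y \<le> x)}"

definition maximal_vectors :: "(real^'n) set \<Rightarrow> (real^'n) set" where
  "maximal_vectors A = {x \<in> A. \<forall>y\<in>A. x \<le> y \<longrightarrow> y = x}"

text \<open>The vectors dominated by \<open>S\<close> are all the feasible ones. \<open>S\<close> keeps the maximal ones and
  their projections, that is, the vectors obtained by setting any subset of coordinates to zero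
  (this is what makes the convex hull coordinate convex).\<close>

definition service_set :: "(real^'n) set \<Rightarrow> bool" where
  "service_set S \<longleftrightarrow> finite S \<and> (\<forall>x\<in>S. 0 \<le> x) \<and>
     S = {coord_proj I x | I x. x \<in> maximal_vectors (dominated S)}"

definition halfspace_region ::
  "nat \<Rightarrow> (nat \<Rightarrow> real^'n) \<Rightarrow> (nat \<Rightarrow> real) \<Rightarrow> (real^'n) set" where
  "halfspace_region L c b = {x. 0 \<le> x \<and> (\<forall>l\<in>{1..L}. c l \<bullet> x \<le> b l)}"

definition minimal_description ::
  "(real^'n) set \<Rightarrow> nat \<Rightarrow> (nat \<Rightarrow> real^'n) \<Rightarrow> (nat \<Rightarrow> real) \<Rightarrow> bool" where
  "minimal_description C L c b \<longleftrightarrow>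
     C = halfspace_region L c b \<and>
     (\<forall>l\<in>{1..L}. 0 \<le> c l \<and> norm (c l) = 1 \<and> 0 < b l) \<and>
     (\<forall>L' c' b'. C = halfspace_region L' c' b' \<longrightarrow> L \<le> L')"

definition capacity_facet :: "(real^'n) set \<Rightarrow> real^'n \<Rightarrow> real \<Rightarrow> (real^'n) set" where
  "capacity_facet C c b = {x \<in> C. c \<bullet> x = b}"


section \<open>The switch under MaxWeight\<close>

definition maxweight :: "(real^'n) set \<Rightarrow> real^'n \<Rightarrow> (real^'n) set" where
  "maxweight S v = {x. is_arg_max (\<lambda>x. x \<bullet> v) (\<lambda>x. x \<in> S) x}"

text \<open>A random tie-breaking rule: in queue state \<open>v\<close> the service vector is drawn from \<open>tie v\<close>,
  for instance uniformly from \<open>maxweight S v\<close>.\<close>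

definition tie_breaking :: "(real^'n) set \<Rightarrow> (real^'n \<Rightarrow> (real^'n) pmf) \<Rightarrow> bool" where
  "tie_breaking S tie \<longleftrightarrow>
     (\<forall>v. set_pmf (tie v) \<subseteq> maxweight S v) \<and>
     (\<forall>x. (\<lambda>v. pmf (tie v) x) \<in> borel_measurable borel)"

definition next_queue :: "real^'n \<Rightarrow> real^'n \<Rightarrow> real^'n \<Rightarrow> real^'n" where
  "next_queue v y x = (\<chi> i. max (v $ i + y $ i - x $ i) 0)"

definition generated :: "'w measure \<Rightarrow> ('w \<Rightarrow> real^'n) set \<Rightarrow> 'w measure" where
  "generated M Xs = sigma (space M) {X -` B \<inter> space M | X B. X \<in> Xs \<and> B \<in> sets borel}"

text \<open>Slots are numbered from \<open>1\<close>; the values at index \<open>0\<close> are irrelevant.\<close>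

locale maxweight_switch = prob_space M
  for M :: "'w measure" +
  fixes S :: "(real^'n) set"
    and tie :: "real^'n \<Rightarrow> (real^'n) pmf"
    and A_max :: real
    and q a s :: "nat \<Rightarrow> 'w \<Rightarrow> real^'n"
  assumes q_rv: "\<And>k. 1 \<le> k \<Longrightarrow> random_variable borel (q k)"
    and a_rv: "\<And>k. 1 \<le> k \<Longrightarrow> random_variable borel (a k)"
    and s_rv: "\<And>k. 1 \<le> k \<Longrightarrow> random_variable borel (s k)"
    and q_nonneg: "\<And>k \<omega>. 1 \<le> k \<Longrightarrow> \<omega> \<in> space M \<Longrightarrow> 0 \<le> q k \<omega>"
    and a_bounded: "\<And>k \<omega> i. 1 \<le> k \<Longrightarrow> \<omega> \<in> space M \<Longrightarrow> a k \<omega> $ i \<in> \<nat> \<and> a k \<omega> $ i \<le> A_max"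
    and a_indep: "indep_vars (\<lambda>_. borel) a {1..}"
    and a_identical: "\<And>k. 1 \<le> k \<Longrightarrow> distr M borel (a k) = distr M borel (a 1)"
    and a_indep_past: "\<And>k. 1 \<le> k \<Longrightarrow>
          indep_set (sets (generated M {a k}))
                    (sets (generated M (q ` {1..k} \<union> s ` {1..k} \<union> a ` {1..<k})))"
    and s_maxweight: "\<And>k \<omega>. 1 \<le> k \<Longrightarrow> \<omega> \<in> space M \<Longrightarrow> s k \<omega> \<in> maxweight S (q k \<omega>)"
    and s_tie: "\<And>k x. 1 \<le> k \<Longrightarrow>
          AE \<omega> in M.
            real_cond_exp M (generated M (q ` {1..k} \<union> s ` {1..<k} \<union> a ` {1..<k}))
              (indicator {\<omega> \<in> space M. s k \<omega> = x}) \<omega> = pmf (tie (q k \<omega>)) x"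
    and dynamics: "\<And>k \<omega>. 1 \<le> k \<Longrightarrow> \<omega> \<in> space M \<Longrightarrow>
          q (Suc k) \<omega> = next_queue (q k \<omega>) (a k \<omega>) (s k \<omega>)"

text \<open>One-step transition law of the queue length chain for arrival law \<open>\<nu>\<close>, and its
  invariant probability laws.\<close>

definition queue_kernel ::
  "(real^'n) measure \<Rightarrow> (real^'n \<Rightarrow> (real^'n) pmf) \<Rightarrow> real^'n \<Rightarrow> (real^'n) measure" where
  "queue_kernel \<nu> tie v =
     distr (\<nu> \<Otimes>\<^sub>M measure_pmf (tie v)) borel (\<lambda>(y, x). next_queue v y x)"

definition steady_state_law ::
  "(real^'n) measure \<Rightarrow> (real^'n \<Rightarrow> (real^'n) pmf) \<Rightarrow> (real^'n) measure \<Rightarrow> bool" where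
  "steady_state_law \<nu> tie \<pi> \<longleftrightarrow>
     prob_space \<pi> \<and> sets \<pi> = sets borel \<and>
     (\<forall>B\<in>sets borel. emeasure \<pi> B = (\<integral>\<^sup>+v. emeasure (queue_kernel \<nu> tie v) B \<partial>\<pi>))"

end

theory Submission
  imports Defs
begin

text \<open>
  Write \<open>c\<close> and \<open>b\<close> for the normal and the offset of the facet, \<open>v\<^sub>\<bottom> = v - \<langle>c,v\<rangle>c\<close> for the component
  of a vector orthogonal to \<open>c\<close>, and let \<open>q\<close>, \<open>x\<close>, \<open>a\<close> be queue, service and arrival of one slot in
  steady state, \<open>q' = q + a - x + u\<close> the next queue vector, \<open>u \<ge> 0\<close> the unused service. These live on
  the product of the law of \<open>(x, q)\<close> with the arrival law, where invariance says that \<open>q'\<close> and \<open>q\<close> have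
  the same law. Functions of \<open>q\<close> may have infinite mean a priori, so equality of the expectations of
  \<open>q'\<close> and \<open>q\<close> is exploited through bounded or truncated functions.

  \<^bold>\<open>State space collapse.\<close> The facet has dimension \<open>n - 1\<close>, because no constraint of a minimal
  description is redundant, so it contains a disc of some radius \<open>\<delta>\<close> around \<open>r\<close>. MaxWeight serves
  \<open>q\<close> at least as well as every point of this disc does, hence \<open>\<langle>q, r - x\<rangle> \<le> - \<delta> \<parallel>q\<^sub>\<bottom>\<parallel>\<close>
  (\<open>maxweight_drift\<close>): the orthogonal component has drift at most about \<open>- \<delta>\<close>, uniformly in \<open>\<epsilon>\<close>.
  With \<open>\<parallel>q\<^sub>\<bottom>\<parallel>\<^sup>4\<close> as Lyapunov function this yields a bound on \<open>E \<parallel>q\<^sub>\<bottom>\<parallel>\<^sup>2\<close> that does not depend on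
  \<open>\<epsilon>\<close> (\<open>perp_second_moment\<close>). So \<open>\<epsilon> q\<close> and \<open>\<epsilon> \<langle>c,q\<rangle> c\<close> have the same limit law.

  \<^bold>\<open>Laplace transform of \<open>\<epsilon>\<langle>c,q\<rangle>\<close>.\<close> Put \<open>t = \<theta>\<epsilon>\<close>. Since \<open>q\<close> and \<open>q'\<close> have the same law, the expectation of
  \<open>exp (- t\<langle>c,q'\<rangle>) - exp (- t\<langle>c,q\<rangle>)\<close> vanishes. Expanding it to second order in \<open>t\<close> gives the drift
  term \<open>t \<epsilon> \<phi>\<close>, the variance term \<open>t\<^sup>2 \<sigma>\<^sup>2 \<phi> / 2\<close>, and two boundary terms: the unused service
  \<open>\<langle>c,u\<rangle>\<close> and the shortfall \<open>b - \<langle>c,x\<rangle>\<close> of services off the facet. The expectations of these two add up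
  to \<open>\<epsilon>\<close>, by balance of mean increments (\<open>rate_balance\<close>). The first is nonzero only where \<open>\<langle>c,q'\<rangle>\<close> is at most a multiple of \<open>\<parallel>q'\<^sub>\<bottom>\<parallel>\<close>, the second only
  where \<open>\<langle>c,q\<rangle>\<close> is at most a multiple of \<open>\<parallel>q\<^sub>\<bottom>\<parallel>\<close> (\<open>unused_service_bound\<close>, \<open>facet_miss_bound\<close>), so by the collapse one may replace the
  exponential next to them by \<open>1\<close>. What remains is \<open>\<phi> (1 + \<theta> \<sigma>\<^sup>2 / 2) = 1 + O(\<surd>\<epsilon>)\<close>
  (\<open>laplace_estimate\<close>), and \<open>1 / (1 + \<theta> \<sigma>\<^sup>2 / 2)\<close> is the Laplace transform of the exponential law
  with mean \<open>\<sigma>\<^sup>2 / 2\<close>. Convergence of Laplace transforms on the natural numbers already implies convergence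
  in distribution on the half-line (\<open>laplace_convergence_in_distribution\<close>).
\<close>

section \<open>Criteria for convergence in distribution\<close>

lemma tendsto_by_approximation:
  fixes u :: "'i \<Rightarrow> real"
  assumes "\<And>e. 0 < e \<Longrightarrow> \<exists>u' l'. (u' \<longlongrightarrow> l') F \<and> (\<forall>\<^sub>F i in F. \<bar>u i - u' i\<bar> \<le> e) \<and> \<bar>l - l'\<bar> \<le> e"
  shows "(u \<longlongrightarrow> l) F"
proof (rule tendstoI)
  fix e :: real assume "0 < e"
  then obtain u' l' where *: "(u' \<longlongrightarrow> l') F" "\<forall>\<^sub>F i in F. \<bar>u i - u' i\<bar> \<le> e / 4" "\<bar>l - l'\<bar> \<le> e / 4"
    using assms[of "e / 4"] by auto
  have "\<forall>\<^sub>F i in F. dist (u' i) l' < e / 4"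
    using *(1) \<open>0 < e\<close> by (intro tendstoD) auto
  with *(2) show "\<forall>\<^sub>F i in F. dist (u i) l < e"
  proof eventually_elim
    case (elim i)
    then show ?case using *(3) \<open>0 < e\<close> unfolding dist_real_def by linarith
  qed
qed

lemma integrable_bounded_prob:
  fixes f :: "'a \<Rightarrow> real"
  assumes "prob_space M" "f \<in> borel_measurable M" "AE x in M. \<bar>f x\<bar> \<le> B"
  shows "integrable M f"
  using assms by (intro finite_measure.integrable_const_bound[where B=B])
    (auto simp: prob_space.finite_measure)

lemma integral_diff_bound:
  fixes f g :: "'a \<Rightarrow> real"
  assumes "integrable M f" "integrable M g" "integrable M h"
    and "AE x in M. \<bar>f x - g x\<bar> \<le> h x"
  shows "\<bar>(\<integral>x. f x \<partial>M) - (\<integral>x. g x \<partial>M)\<bar> \<le> (\<integral>x. h x \<partial>M)"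
proof -
  have "\<bar>(\<integral>x. f x \<partial>M) - (\<integral>x. g x \<partial>M)\<bar> = norm (\<integral>x. f x - g x \<partial>M)"
    using assms by simp
  also have "\<dots> \<le> (\<integral>x. norm (f x - g x) \<partial>M)"
    by (rule integral_norm_bound)
  also have "\<dots> \<le> (\<integral>x. h x \<partial>M)"
    using assms by (intro integral_mono_AE) auto
  finally show ?thesis .
qed

text \<open>
  The map \<open>x \<mapsto> exp (- x)\<close> sends the half-line into the compact interval \<open>{0..1}\<close>, where \<open>h\<close> is
  uniformly close to a polynomial; the integral of a polynomial in \<open>exp (- x)\<close> is a linear combination
  of values of the Laplace transform at natural numbers.
\<close>

lemma laplace_convergence_exp_image:
  fixes \<mu> :: "'i \<Rightarrow> real measure" and h :: "real \<Rightarrow> real"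
  assumes \<mu>: "\<forall>\<^sub>F i in F. prob_space (\<mu> i) \<and> sets (\<mu> i) = sets borel \<and> (AE x in \<mu> i. 0 \<le> x)"
    and \<nu>: "prob_space \<nu>" "sets \<nu> = sets borel" "AE x in \<nu>. 0 \<le> x"
    and lap: "\<And>k::nat. ((\<lambda>i. \<integral>x. exp (- (real k * x)) \<partial>\<mu> i) \<longlongrightarrow> (\<integral>x. exp (- (real k * x)) \<partial>\<nu>)) F"
    and h: "continuous_on UNIV h"
  shows "((\<lambda>i. \<integral>x. h (exp (- x)) \<partial>\<mu> i) \<longlongrightarrow> (\<integral>x. h (exp (- x)) \<partial>\<nu>)) F"
proof (rule tendsto_by_approximation)
  fix e :: real assume "0 < e"
  have "compact {0..1::real}" "continuous_on {0..1} h"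
    using h continuous_on_subset by auto
  from Stone_Weierstrass_real_polynomial_function[OF this \<open>0 < e\<close>]
  obtain g where g: "real_polynomial_function g" "\<And>x. x \<in> {0..1} \<Longrightarrow> \<bar>h x - g x\<bar> < e"
    by auto
  then obtain c n where gc: "g = (\<lambda>x. \<Sum>i\<le>n. c i * x ^ i)"
    unfolding real_polynomial_function_iff_sum by auto
  have P: "(\<integral>x. g (exp (- x)) \<partial>M) = (\<Sum>k\<le>n. c k * (\<integral>x. exp (- (real k * x)) \<partial>M)) \<and>
           \<bar>(\<integral>x. h (exp (- x)) \<partial>M) - (\<integral>x. g (exp (- x)) \<partial>M)\<bar> \<le> e"
    if M: "prob_space M" "sets M = sets borel" "AE x in M. 0 \<le> x" for M :: "real measure"
  proof
    interpret prob_space M by fact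
    have [measurable_cong]: "sets M = sets borel" by fact
    have "integrable M (\<lambda>x. exp (- (real k * x)))" for k
      by (rule integrable_bounded_prob[where B=1]) (use M in \<open>auto elim!: eventually_mono\<close>)
    then show "(\<integral>x. g (exp (- x)) \<partial>M) = (\<Sum>k\<le>n. c k * (\<integral>x. exp (- (real k * x)) \<partial>M))"
      by (simp add: gc exp_of_nat_mult[symmetric])
    have hm [measurable]: "h \<in> borel_measurable borel"
      using h by (rule borel_measurable_continuous_onI)
    have gcont: "continuous_on UNIV g" unfolding gc by (intro continuous_intros)
    then have gm [measurable]: "g \<in> borel_measurable borel"
      by (rule borel_measurable_continuous_onI)
    have bd: "\<exists>B. \<forall>x\<in>{0..1}. \<bar>p x\<bar> \<le> B" if "continuous_on UNIV p" for p :: "real \<Rightarrow> real"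
    proof -
      have "compact (p ` {0..1})"
        using that by (intro compact_continuous_image) (auto intro: continuous_on_subset)
      then show ?thesis
        using compact_imp_bounded bounded_iff by (metis image_eqI real_norm_def)
    qed
    have int: "integrable M (\<lambda>x. p (exp (- x)))" if p: "continuous_on UNIV p" for p :: "real \<Rightarrow> real"
    proof -
      obtain B where B: "\<forall>x\<in>{0..1}. \<bar>p x\<bar> \<le> B" using bd[OF p] by auto
      have [measurable]: "p \<in> borel_measurable borel"
        using p by (rule borel_measurable_continuous_onI)
      show ?thesis
        by (rule integrable_bounded_prob[where B=B])
          (use M B in \<open>auto elim!: eventually_mono\<close>)
    qed
    have "\<bar>(\<integral>x. h (exp (- x)) \<partial>M) - (\<integral>x. g (exp (- x)) \<partial>M)\<bar> \<le> (\<integral>x. e \<partial>M)"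
      using M(3) by (intro integral_diff_bound int h gcont)
        (auto elim!: eventually_mono intro!: less_imp_le g(2))
    then show "\<bar>(\<integral>x. h (exp (- x)) \<partial>M) - (\<integral>x. g (exp (- x)) \<partial>M)\<bar> \<le> e"
      by (simp add: prob_space)
  qed
  have "((\<lambda>i. \<Sum>k\<le>n. c k * (\<integral>x. exp (- (real k * x)) \<partial>\<mu> i)) \<longlongrightarrow>
         (\<Sum>k\<le>n. c k * (\<integral>x. exp (- (real k * x)) \<partial>\<nu>))) F"
    by (intro tendsto_intros lap)
  moreover have "\<forall>\<^sub>F i in F. \<bar>(\<integral>x. h (exp (- x)) \<partial>\<mu> i) -
      (\<Sum>k\<le>n. c k * (\<integral>x. exp (- (real k * x)) \<partial>\<mu> i))\<bar> \<le> e"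
    using \<mu>
  proof eventually_elim
    case (elim i)
    with P[of "\<mu> i"] show ?case by metis
  qed
  moreover have "\<bar>(\<integral>x. h (exp (- x)) \<partial>\<nu>) -
      (\<Sum>k\<le>n. c k * (\<integral>x. exp (- (real k * x)) \<partial>\<nu>))\<bar> \<le> e"
    using P[OF \<nu>] by metis
  ultimately show "\<exists>u' l'. (u' \<longlongrightarrow> l') F \<and>
      (\<forall>\<^sub>F i in F. \<bar>(\<integral>x. h (exp (- x)) \<partial>\<mu> i) - u' i\<bar> \<le> e) \<and> \<bar>(\<integral>x. h (exp (- x)) \<partial>\<nu>) - l'\<bar> \<le> e"
    by blast
qed

text \<open>
  A bounded continuous \<open>f\<close> becomes a continuous function of \<open>y = exp (- x)\<close> on all of \<open>{0..1}\<close> once it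
  is multiplied by a cut-off that vanishes at \<open>y = 0\<close>, that is, at \<open>x = \<infinity>\<close>. Tightness comes for free: the
  expectation of what the cut-off removes converges as well, and it is small under the limit law.
\<close>

lemma laplace_convergence_in_distribution:
  fixes \<mu> :: "'i \<Rightarrow> real measure"
  assumes \<mu>: "\<forall>\<^sub>F i in F. prob_space (\<mu> i) \<and> sets (\<mu> i) = sets borel \<and> (AE x in \<mu> i. 0 \<le> x)"
    and \<nu>: "prob_space \<nu>" "sets \<nu> = sets borel" "AE x in \<nu>. 0 \<le> x"
    and lap: "\<And>k::nat. ((\<lambda>i. \<integral>x. exp (- (real k * x)) \<partial>\<mu> i) \<longlongrightarrow> (\<integral>x. exp (- (real k * x)) \<partial>\<nu>)) F"
  shows "converges_in_distribution \<mu> \<nu> F"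
  unfolding converges_in_distribution_def
proof (intro allI impI, elim conjE)
  fix f :: "real \<Rightarrow> real"
  assume f: "continuous_on UNIV f" and bf: "bounded (range f)"
  obtain B where B: "0 < B" "\<And>x. \<bar>f x\<bar> \<le> B"
    using bf unfolding bounded_pos by auto
  have fm [measurable]: "f \<in> borel_measurable borel"
    using f by (rule borel_measurable_continuous_onI)
  show "((\<lambda>i. \<integral>x. f x \<partial>\<mu> i) \<longlongrightarrow> (\<integral>x. f x \<partial>\<nu>)) F"
  proof (rule tendsto_by_approximation)
    fix e :: real assume e: "0 < e"
    define cut where "cut \<rho> y = max 0 (min 1 (y / \<rho>))" for \<rho> y :: real
    have cut01: "0 \<le> cut \<rho> y" "cut \<rho> y \<le> 1" for \<rho> y
      by (auto simp: cut_def)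
    have [measurable]: "cut \<rho> \<in> borel_measurable borel" for \<rho>
      unfolding cut_def by measurable
    have "(\<lambda>n. \<integral>x. 1 - cut (1 / real (Suc n)) (exp (- x)) \<partial>\<nu>) \<longlonglongrightarrow> (\<integral>x. 0 \<partial>\<nu>)"
    proof (rule integral_dominated_convergence[where w="\<lambda>_. 1"])
      interpret prob_space \<nu> by fact
      show "integrable \<nu> (\<lambda>_. 1::real)" by simp
      have [measurable_cong]: "sets \<nu> = sets borel" by fact
      show "(\<lambda>x. 1 - cut (1 / real (Suc n)) (exp (- x))) \<in> borel_measurable \<nu>" for n
        by measurable
      show "AE x in \<nu>. norm (1 - cut (1 / real (Suc n)) (exp (- x))) \<le> 1" for n
        using cut01 by (intro AE_I2) auto
      show "AE x in \<nu>. (\<lambda>n. 1 - cut (1 / real (Suc n)) (exp (- x))) \<longlonglongrightarrow> 0"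
      proof (intro AE_I2 tendsto_eventually)
        fix x :: real
        obtain n0 where n0: "exp x \<le> real n0" using real_arch_simple by blast
        have "cut (1 / real (Suc n)) (exp (- x)) = 1" if "n \<ge> n0" for n
        proof -
          have "1 = exp (- x) * exp x" by (simp add: exp_minus)
          also have "\<dots> \<le> exp (- x) * real (Suc n)"
            using n0 that by (intro mult_left_mono) auto
          finally show ?thesis by (simp add: cut_def)
        qed
        then show "\<forall>\<^sub>F n in sequentially. 1 - cut (1 / real (Suc n)) (exp (- x)) = 0"
          unfolding eventually_sequentially by auto
      qed
    qed auto
    then have "\<forall>\<^sub>F n in sequentially. (\<integral>x. 1 - cut (1 / real (Suc n)) (exp (- x)) \<partial>\<nu>) < e / B"
      using e B by (intro order_tendstoD(2)) auto
    then obtain n where n: "(\<integral>x. 1 - cut (1 / real (Suc n)) (exp (- x)) \<partial>\<nu>) < e / B"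
      using eventually_happens'[OF sequentially_bot] by blast
    define \<rho> where "\<rho> = 1 / real (Suc n)"
    have \<rho>: "0 < \<rho>" "(\<integral>x. 1 - cut \<rho> (exp (- x)) \<partial>\<nu>) < e / B"
      using n by (auto simp: \<rho>_def)
    have cut_c: "continuous_on UNIV (cut \<rho>)"
      unfolding cut_def by (intro continuous_intros) (use \<rho> in auto)
    \<comment> \<open>The cut-off kills \<open>f (- ln y)\<close> at \<open>y = 0\<close>, where it need not have a limit.\<close>
    define h where "h y = f (- ln y) * cut \<rho> y" for y
    have hexp: "h (exp (- x)) = f x * cut \<rho> (exp (- x))" for x
      by (simp add: h_def)
    have hc: "continuous_on UNIV h"
    proof -
      have "isCont h y" for y
      proof (cases "y = 0")
        case False
        have "isCont f (- ln y)" using f by (simp add: continuous_on_eq_continuous_at)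
        moreover have "isCont (cut \<rho>) y" using cut_c by (simp add: continuous_on_eq_continuous_at)
        moreover have "isCont (\<lambda>y. - ln y) y" using False by (intro continuous_intros) auto
        ultimately show ?thesis
          using False unfolding h_def by (intro continuous_intros isCont_o2[of y "\<lambda>y. - ln y" f]) auto
      next
        case True
        have "((\<lambda>y. B * cut \<rho> y) \<longlongrightarrow> B * cut \<rho> 0) (at 0)"
          using cut_c by (intro tendsto_intros) (simp add: continuous_on_eq_continuous_at isCont_def)
        then have "((\<lambda>y. B * cut \<rho> y) \<longlongrightarrow> 0) (at 0)" by (simp add: cut_def)
        then have "(h \<longlongrightarrow> 0) (at 0)"
        proof (rule Lim_null_comparison[rotated])
          show "\<forall>\<^sub>F x in at 0. norm (h x) \<le> B * cut \<rho> x"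
            using B(2) cut01 by (auto simp: h_def abs_mult intro!: always_eventually mult_right_mono)
        qed
        then show ?thesis using True by (simp add: isCont_def h_def cut_def)
      qed
      then show ?thesis by (simp add: continuous_on_eq_continuous_at)
    qed
    have near: "\<bar>(\<integral>x. f x \<partial>M) - (\<integral>x. h (exp (- x)) \<partial>M)\<bar> \<le> B * (\<integral>x. 1 - cut \<rho> (exp (- x)) \<partial>M)"
      if M: "prob_space M" "sets M = sets borel" for M :: "real measure"
    proof -
      interpret prob_space M by fact
      have [measurable_cong]: "sets M = sets borel" by fact
      have "\<bar>(\<integral>x. f x \<partial>M) - (\<integral>x. f x * cut \<rho> (exp (- x)) \<partial>M)\<bar> \<le> (\<integral>x. B * (1 - cut \<rho> (exp (- x))) \<partial>M)"
      proof (rule integral_diff_bound)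
        show "integrable M f" using B by (intro integrable_bounded_prob[where B=B] M) auto
        have "\<bar>f x * cut \<rho> (exp (- x))\<bar> \<le> B" for x
          using mult_mono[OF B(2)[of x] cut01(2)[of \<rho> "exp (- x)"]] B(1) cut01(1)[of \<rho> "exp (- x)"]
          by (auto simp: abs_mult)
        then show "integrable M (\<lambda>x. f x * cut \<rho> (exp (- x)))"
          by (intro integrable_bounded_prob[where B=B] M) auto
        have "\<bar>1 - cut \<rho> (exp (- x))\<bar> \<le> 1" for x using cut01[of \<rho> "exp (- x)"] by auto
        then show "integrable M (\<lambda>x. B * (1 - cut \<rho> (exp (- x))))"
          by (intro integrable_mult_right integrable_bounded_prob[where B=1] M) auto
        have "\<bar>f x - f x * cut \<rho> (exp (- x))\<bar> \<le> B * (1 - cut \<rho> (exp (- x)))" for x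
        proof -
          have "f x - f x * cut \<rho> (exp (- x)) = f x * (1 - cut \<rho> (exp (- x)))"
            by (simp add: right_diff_distrib)
          then have "\<bar>f x - f x * cut \<rho> (exp (- x))\<bar> = \<bar>f x\<bar> * (1 - cut \<rho> (exp (- x)))"
            using cut01(2)[of \<rho> "exp (- x)"] by (simp add: abs_mult)
          then show ?thesis using B cut01[of \<rho> "exp (- x)"] by (simp add: mult_right_mono)
        qed
        then show "AE x in M. \<bar>f x - f x * cut \<rho> (exp (- x))\<bar> \<le> B * (1 - cut \<rho> (exp (- x)))"
          by simp
      qed
      then show ?thesis by (simp add: hexp)
    qed
    have lim: "((\<lambda>i. \<integral>x. p (exp (- x)) \<partial>\<mu> i) \<longlongrightarrow> (\<integral>x. p (exp (- x)) \<partial>\<nu>)) F"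
      if "continuous_on UNIV p" for p :: "real \<Rightarrow> real"
      by (rule laplace_convergence_exp_image) (use assms that in auto)
    have "((\<lambda>i. \<integral>x. 1 - cut \<rho> (exp (- x)) \<partial>\<mu> i) \<longlongrightarrow> (\<integral>x. 1 - cut \<rho> (exp (- x)) \<partial>\<nu>)) F"
      by (rule lim[of "\<lambda>y. 1 - cut \<rho> y"]) (intro continuous_intros cut_c)
    then have "\<forall>\<^sub>F i in F. (\<integral>x. 1 - cut \<rho> (exp (- x)) \<partial>\<mu> i) < e / B"
      using \<rho>(2) by (rule order_tendstoD)
    with \<mu> have "\<forall>\<^sub>F i in F. \<bar>(\<integral>x. f x \<partial>\<mu> i) - (\<integral>x. h (exp (- x)) \<partial>\<mu> i)\<bar> \<le> e"
    proof eventually_elim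
      case (elim i)
      with near[of "\<mu> i"] B(1) show ?case by (auto simp: field_simps)
    qed
    moreover have "\<bar>(\<integral>x. f x \<partial>\<nu>) - (\<integral>x. h (exp (- x)) \<partial>\<nu>)\<bar> \<le> e"
      using near[of \<nu>] \<nu> \<rho>(2) B(1) by (auto simp: field_simps)
    ultimately show "\<exists>u' l'. (u' \<longlongrightarrow> l') F \<and> (\<forall>\<^sub>F i in F. \<bar>(\<integral>x. f x \<partial>\<mu> i) - u' i\<bar> \<le> e) \<and>
        \<bar>(\<integral>x. f x \<partial>\<nu>) - l'\<bar> \<le> e"
      using lim[OF hc] by blast
  qed
qed

text \<open>
  Slutsky's theorem. On a ball that carries most of the mass of the limit, \<open>f\<close> is uniformly continuous,
  so there the small difference of \<open>X\<close> and \<open>Z\<close> changes \<open>f\<close> little.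
\<close>

lemma converges_in_distribution_close:
  fixes X Z :: "'i \<Rightarrow> 'w \<Rightarrow> 'a::euclidean_space"
  assumes rv: "\<forall>\<^sub>F i in F. prob_space (N i) \<and> X i \<in> borel_measurable (N i) \<and> Z i \<in> borel_measurable (N i)"
    and \<mu>: "prob_space \<mu>" "sets \<mu> = sets borel"
    and X: "converges_in_distribution (\<lambda>i. distr (N i) borel (X i)) \<mu> F"
    and near: "\<And>d. 0 < d \<Longrightarrow> ((\<lambda>i. measure (N i) {w \<in> space (N i). d \<le> norm (Z i w - X i w)}) \<longlongrightarrow> 0) F"
  shows "converges_in_distribution (\<lambda>i. distr (N i) borel (Z i)) \<mu> F"
  unfolding converges_in_distribution_def
proof (intro allI impI, elim conjE)
  fix f :: "'a \<Rightarrow> real"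
  assume f: "continuous_on UNIV f" and bf: "bounded (range f)"
  obtain B where B: "0 < B" "\<And>x. \<bar>f x\<bar> \<le> B"
    using bf unfolding bounded_pos by auto
  have fm [measurable]: "f \<in> borel_measurable borel"
    using f by (rule borel_measurable_continuous_onI)
  interpret \<mu>: prob_space \<mu> by fact
  have [measurable_cong]: "sets \<mu> = sets borel" by fact
  show "((\<lambda>i. \<integral>x. f x \<partial>distr (N i) borel (Z i)) \<longlongrightarrow> (\<integral>x. f x \<partial>\<mu>)) F"
  proof (rule tendsto_by_approximation)
    fix e :: real assume e: "0 < e"
    \<comment> \<open>A continuous function that detects large norms, so that its expectation passes to the limit.\<close>
    define far where "far R x = min 1 (max 0 (norm x - R))" for R and x :: 'a
    have far01: "0 \<le> far R x" "far R x \<le> 1" for R x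
      by (auto simp: far_def)
    have far_c: "continuous_on UNIV (far R)" for R
      unfolding far_def by (intro continuous_intros)
    have far_m [measurable]: "far R \<in> borel_measurable borel" for R
      by (intro borel_measurable_continuous_onI far_c)
    have "(\<lambda>n. \<integral>x. far (real n) x \<partial>\<mu>) \<longlonglongrightarrow> (\<integral>x. 0 \<partial>\<mu>)"
    proof (rule integral_dominated_convergence[where w="\<lambda>_. 1"])
      show "integrable \<mu> (\<lambda>_. 1::real)" by simp
      show "AE x in \<mu>. norm (far (real n) x) \<le> 1" for n
        using far01 by simp
      show "AE x in \<mu>. (\<lambda>n. far (real n) x) \<longlonglongrightarrow> 0"
      proof (intro AE_I2 tendsto_eventually)
        fix x :: 'a
        obtain n0 where n0: "norm x \<le> real n0" using real_arch_simple by blast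
        have "far (real n) x = 0" if "n \<ge> n0" for n
          using n0 that by (simp add: far_def)
        then show "\<forall>\<^sub>F n in sequentially. far (real n) x = 0"
          unfolding eventually_sequentially by auto
      qed
    qed auto
    then have "\<forall>\<^sub>F n in sequentially. (\<integral>x. far (real n) x \<partial>\<mu>) < e / (8 * B)"
      using e B by (intro order_tendstoD(2)) auto
    then obtain n where n: "(\<integral>x. far (real n) x \<partial>\<mu>) < e / (8 * B)"
      using eventually_happens'[OF sequentially_bot] by blast
    define R where "R = real n"
    have "uniformly_continuous_on (cball 0 (R + 2)) f"
      by (intro compact_uniformly_continuous continuous_on_subset[OF f]) auto
    then obtain d0 where d0: "0 < d0" "\<And>x y. x \<in> cball 0 (R + 2) \<Longrightarrow> y \<in> cball 0 (R + 2) \<Longrightarrow>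
        dist y x < d0 \<Longrightarrow> dist (f y) (f x) < e / 2"
      using e unfolding uniformly_continuous_on_def by (meson half_gt_zero)
    define d where "d = min d0 1"
    have d: "0 < d" using d0 by (simp add: d_def)
    have pw: "\<bar>f z - f x\<bar> \<le> e / 2 + 2 * B * of_bool (d \<le> norm (z - x)) + 2 * B * far R x" for z x
    proof -
      have le2B: "\<bar>f z - f x\<bar> \<le> 2 * B" using B(2)[of z] B(2)[of x] by linarith
      consider "d \<le> norm (z - x)" | "norm x \<ge> R + 1" | "norm (z - x) < d" "norm x < R + 1"
        by linarith
      then show ?thesis
      proof cases
        case 1
        have "0 \<le> 2 * B * far R x" using B(1) far01(1)[of R x] by simp
        then show ?thesis using 1 le2B e by simp
      next
        case 2
        then have "far R x = 1" by (simp add: far_def)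
        then show ?thesis using le2B e B(1) by simp
      next
        case 3
        then have "norm z \<le> R + 2" using norm_triangle_sub[of z x] by (simp add: d_def)
        then have "dist (f z) (f x) < e / 2"
          using 3 by (intro d0(2)) (auto simp: dist_norm d_def)
        moreover have "0 \<le> 2 * B * far R x" using B(1) far01(1)[of R x] by simp
        ultimately show ?thesis using 3 by (simp add: dist_real_def)
      qed
    qed
    have "((\<lambda>i. \<integral>x. far R x \<partial>distr (N i) borel (X i)) \<longlongrightarrow> (\<integral>x. far R x \<partial>\<mu>)) F"
    proof -
      have "bounded (range (far R))"
        using far01 by (auto simp: bounded_iff intro!: exI[of _ 1])
      with far_c[of R] X show ?thesis unfolding converges_in_distribution_def by blast
    qed
    then have "\<forall>\<^sub>F i in F. (\<integral>x. far R x \<partial>distr (N i) borel (X i)) < e / (8 * B)"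
      using n by (intro order_tendstoD(2)) (auto simp: R_def)
    moreover have "\<forall>\<^sub>F i in F. measure (N i) {w \<in> space (N i). d \<le> norm (Z i w - X i w)} < e / (8 * B)"
      using near[OF d] e B by (intro order_tendstoD(2)) auto
    ultimately have "\<forall>\<^sub>F i in F. \<bar>(\<integral>x. f x \<partial>distr (N i) borel (Z i)) - (\<integral>x. f x \<partial>distr (N i) borel (X i))\<bar> \<le> e"
      using rv
    proof eventually_elim
      case (elim i)
      interpret prob_space "N i" using elim by simp
      have [measurable]: "X i \<in> borel_measurable (N i)" "Z i \<in> borel_measurable (N i)"
        using elim by auto
      define E where "E = {w \<in> space (N i). d \<le> norm (Z i w - X i w)}"
      have [measurable]: "E \<in> sets (N i)" unfolding E_def by measurable
      have int_far: "integrable (N i) (\<lambda>w. far R (X i w))"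
        using far01 by (intro integrable_const_bound[where B=1]) auto
      have int_E: "integrable (N i) (indicat_real E)"
        by (auto simp: integrable_indicator_iff less_top[symmetric])
      have "\<bar>(\<integral>w. f (Z i w) \<partial>N i) - (\<integral>w. f (X i w) \<partial>N i)\<bar>
          \<le> (\<integral>w. e / 2 + 2 * B * indicator E w + 2 * B * far R (X i w) \<partial>N i)"
      proof (rule integral_diff_bound)
        show "integrable (N i) (\<lambda>w. f (Z i w))" "integrable (N i) (\<lambda>w. f (X i w))"
          using B by (auto intro!: integrable_const_bound[where B=B])
        show "integrable (N i) (\<lambda>w. e / 2 + 2 * B * indicator E w + 2 * B * far R (X i w))"
          using int_far int_E by (intro Bochner_Integration.integrable_add integrable_mult_right) auto
        show "AE w in N i. \<bar>f (Z i w) - f (X i w)\<bar> \<le> e / 2 + 2 * B * indicator E w + 2 * B * far R (X i w)"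
        proof (rule AE_I2)
          fix w assume "w \<in> space (N i)"
          then have "indicator E w = (of_bool (d \<le> norm (Z i w - X i w)) :: real)"
            by (auto simp: E_def)
          then show "\<bar>f (Z i w) - f (X i w)\<bar> \<le> e / 2 + 2 * B * indicator E w + 2 * B * far R (X i w)"
            using pw[of "Z i w" "X i w"] by simp
        qed
      qed
      also have "\<dots> = e / 2 + 2 * B * measure (N i) E + 2 * B * (\<integral>w. far R (X i w) \<partial>N i)"
        using int_far int_E by (simp add: prob_space)
      also have "\<dots> \<le> e / 2 + 2 * B * (e / (8 * B)) + 2 * B * (e / (8 * B))"
        using elim B(1) by (intro add_mono mult_left_mono) (auto simp: E_def integral_distr)
      also have "\<dots> = e" using B(1) by (simp add: field_simps)
      finally show ?case by (simp add: integral_distr)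
    qed
    moreover have "((\<lambda>i. \<integral>x. f x \<partial>distr (N i) borel (X i)) \<longlongrightarrow> (\<integral>x. f x \<partial>\<mu>)) F"
      using X f bf by (auto simp: converges_in_distribution_def)
    ultimately show "\<exists>u' l'. (u' \<longlongrightarrow> l') F \<and>
        (\<forall>\<^sub>F i in F. \<bar>(\<integral>x. f x \<partial>distr (N i) borel (Z i)) - u' i\<bar> \<le> e) \<and> \<bar>(\<integral>x. f x \<partial>\<mu>) - l'\<bar> \<le> e"
      using e by (intro exI[of _ "\<lambda>i. \<integral>x. f x \<partial>distr (N i) borel (X i)"] exI[of _ "\<integral>x. f x \<partial>\<mu>"]) auto
  qed
qed

lemma converges_in_distribution_continuous_image:
  fixes g :: "'a::topological_space \<Rightarrow> 'b::topological_space"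
  assumes "converges_in_distribution \<mu> \<nu> F" and g: "continuous_on UNIV g"
    and "\<forall>\<^sub>F i in F. sets (\<mu> i) = sets borel" "sets \<nu> = sets borel"
  shows "converges_in_distribution (\<lambda>i. distr (\<mu> i) borel g) (distr \<nu> borel g) F"
  unfolding converges_in_distribution_def
proof (intro allI impI, elim conjE)
  fix f :: "'b \<Rightarrow> real"
  assume f: "continuous_on UNIV f" and bf: "bounded (range f)"
  have gm: "g \<in> measurable M borel" if "sets M = sets borel" for M
    using borel_measurable_continuous_onI[OF g] that by (simp cong: measurable_cong_sets)
  have fm: "f \<in> borel_measurable borel" using f by (rule borel_measurable_continuous_onI)
  have "continuous_on UNIV (\<lambda>x. f (g x))"
    using continuous_on_compose2[OF f g] by simp
  moreover have "bounded (range (\<lambda>x. f (g x)))"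
    using bf by (rule bounded_subset) auto
  ultimately have "((\<lambda>i. \<integral>x. f (g x) \<partial>\<mu> i) \<longlongrightarrow> (\<integral>x. f (g x) \<partial>\<nu>)) F"
    using assms(1) by (simp add: converges_in_distribution_def)
  moreover have "\<forall>\<^sub>F i in F. (\<integral>x. f (g x) \<partial>\<mu> i) = (\<integral>x. f x \<partial>distr (\<mu> i) borel g)"
    using assms(3) by eventually_elim (simp add: integral_distr gm fm)
  ultimately show "((\<lambda>i. \<integral>x. f x \<partial>distr (\<mu> i) borel g) \<longlongrightarrow> (\<integral>x. f x \<partial>distr \<nu> borel g)) F"
    using assms(4) by (simp add: integral_distr gm fm tendsto_cong)
qed

lemma exponential_distribution_laplace:
  assumes m: "0 \<le> m" and k: "0 \<le> k"
  shows "prob_space (exponential_distribution m)" "sets (exponential_distribution m) = sets borel"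
    "AE x in exponential_distribution m. 0 \<le> x"
    "(\<integral>x. exp (- (k * x)) \<partial>exponential_distribution m) = 1 / (1 + k * m)"
proof -
  have "prob_space (exponential_distribution m) \<and> sets (exponential_distribution m) = sets borel \<and>
    (AE x in exponential_distribution m. 0 \<le> x) \<and>
    (\<integral>x. exp (- (k * x)) \<partial>exponential_distribution m) = 1 / (1 + k * m)"
  proof (cases "m = 0")
    case True
    then have E: "exponential_distribution m = return borel 0" by (simp add: exponential_distribution_def)
    have "AE x in return borel (0::real). 0 \<le> x" by (subst AE_return) auto
    then show ?thesis
      unfolding E using True by (intro conjI) (auto simp: prob_space_return integral_return)
  next
    case False
    define r where "r = 1 / m"
    have r: "0 < r" using False m by (simp add: r_def)
    have D: "exponential_distribution m = density lborel (exponential_density r)"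
      using False by (simp add: exponential_distribution_def r_def)
    have nonneg: "0 \<le> exponential_density l x" if "0 < l" for l x
      using that by (simp add: exponential_density_def)
    have "AE x in density lborel (exponential_density r). 0 \<le> x"
      by (subst AE_density) (auto simp: exponential_density_def)
    moreover have "(\<integral>x. exp (- (k * x)) \<partial>density lborel (exponential_density r)) = 1 / (1 + k * m)"
    proof -
      interpret P: prob_space "density lborel (exponential_density (r + k))"
        using r k by (intro prob_space_exponential_density) auto
      have "(\<integral>x. exp (- (k * x)) \<partial>density lborel (exponential_density r)) =
            (\<integral>x. exponential_density r x * exp (- (k * x)) \<partial>lborel)"
        using nonneg[OF r] by (subst integral_density) auto
      also have "\<dots> = (\<integral>x. r / (r + k) * (exponential_density (r + k) x * 1) \<partial>lborel)"
      proof (intro Bochner_Integration.integral_cong refl)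
        fix x
        have "exp (- x * r) * exp (- (k * x)) = exp (- x * (r + k))"
          by (simp add: exp_add[symmetric] algebra_simps)
        then show "exponential_density r x * exp (- (k * x)) = r / (r + k) * (exponential_density (r + k) x * 1)"
          using r k by (simp add: exponential_density_def)
      qed
      also have "\<dots> = r / (r + k) * (\<integral>x. 1 \<partial>density lborel (exponential_density (r + k)))"
        using nonneg[of "r + k"] r k by (subst integral_density) auto
      also have "\<dots> = 1 / (1 + k * m)"
        using r k P.prob_space False by (simp add: r_def field_simps)
      finally show ?thesis .
    qed
    ultimately show ?thesis
      unfolding D using prob_space_exponential_density[OF r] by simp
  qed
  then show "prob_space (exponential_distribution m)" "sets (exponential_distribution m) = sets borel"
    "AE x in exponential_distribution m. 0 \<le> x"
    "(\<integral>x. exp (- (k * x)) \<partial>exponential_distribution m) = 1 / (1 + k * m)"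
    by auto
qed

section \<open>Geometry of the facet\<close>

text \<open>
  State space collapse means that this component of the queue vector stays bounded in mean square while the
  projection on \<open>c\<close> grows like \<open>1 / \<epsilon>\<close>.
\<close>

definition perp :: "real^'n \<Rightarrow> real^'n \<Rightarrow> real^'n" where
  "perp c v = v - (c \<bullet> v) *\<^sub>R c"

text \<open>
  Otherwise constraint \<open>l\<close> would follow from the others and could be dropped, leaving a description
  with \<open>L - 1\<close> half-spaces.
\<close>

lemma minimal_description_irredundant:
  fixes C :: "(real^'n) set"
  assumes "minimal_description C L c b" "l \<in> {1..L}"
  obtains z where "0 \<le> z" "\<And>j. j \<in> {1..L} - {l} \<Longrightarrow> c j \<bullet> z \<le> b j" "b l < c l \<bullet> z"
proof -
  have C: "C = halfspace_region L c b"
    and min: "\<And>L' c' b'. C = halfspace_region L' c' b' \<Longrightarrow> L \<le> L'"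
    using assms(1) unfolding minimal_description_def by blast+
  have "\<exists>z\<ge>0. (\<forall>j\<in>{1..L} - {l}. c j \<bullet> z \<le> b j) \<and> b l < c l \<bullet> z"
  proof (rule ccontr)
    assume "\<not> ?thesis"
    then have red: "c l \<bullet> z \<le> b l" if "0 \<le> z" "\<forall>j\<in>{1..L} - {l}. c j \<bullet> z \<le> b j" for z
      using that by force
    \<comment> \<open>Dropping constraint \<open>l\<close> means moving the last constraint into its slot.\<close>
    define \<sigma> where "\<sigma> j = (if j = l then L else j)" for j
    have \<sigma>: "{1..L} - {l} \<subseteq> \<sigma> ` {1..L - 1} "
    proof
      fix j assume j: "j \<in> {1..L} - {l}"
      show "j \<in> \<sigma> ` {1..L - 1}"
      proof (cases "j = L")
        case True
        then have "l \<in> {1..L - 1}" "\<sigma> l = j" using j assms(2) by (auto simp: \<sigma>_def)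
        then show ?thesis by blast
      next
        case False
        then have "j \<in> {1..L - 1}" "\<sigma> j = j" using j by (auto simp: \<sigma>_def)
        then show ?thesis by force
      qed
    qed
    have \<sigma>': "\<sigma> ` {1..L - 1} \<subseteq> {1..L}"
      using assms(2) by (auto simp: \<sigma>_def)
    have "C = halfspace_region (L - 1) (c \<circ> \<sigma>) (b \<circ> \<sigma>)"
      unfolding C halfspace_region_def
    proof (intro Collect_cong conj_cong refl iffI ballI)
      fix z j assume "\<forall>l\<in>{1..L}. c l \<bullet> z \<le> b l" "j \<in> {1..L - 1}"
      then show "(c \<circ> \<sigma>) j \<bullet> z \<le> (b \<circ> \<sigma>) j" using \<sigma>' unfolding comp_def by blast
    next
      fix z j
      assume z: "0 \<le> z" "\<forall>l\<in>{1..L - 1}. (c \<circ> \<sigma>) l \<bullet> z \<le> (b \<circ> \<sigma>) l" and j: "j \<in> {1..L}"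
      have "\<forall>j\<in>{1..L} - {l}. c j \<bullet> z \<le> b j"
        using \<sigma> z(2) by (fastforce dest: subsetD)
      with red[OF z(1) this] show "c j \<bullet> z \<le> b j" using j by (cases "j = l") auto
    qed
    from min[OF this] show False using assms(2) by auto
  qed
  then show thesis using that by auto
qed

text \<open>
  This says that the facet has full dimension \<open>n - 1\<close>. The segment from a strictly interior point \<open>p\<close> to
  a point \<open>z\<close> that violates only constraint \<open>l\<close> meets the hyperplane in a point \<open>y\<close> at which all other
  constraints, positivity included, are strict. A small disc around \<open>y\<close> therefore lies in the facet, whose affine hull is
  the whole hyperplane, and the relative interior of the facet is its interior in that hyperplane.
\<close>

lemma facet_contains_disc:
  fixes C :: "(real^'n) set"
  assumes md: "minimal_description C L c b" and l: "l \<in> {1..L}"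
    and r: "r \<in> rel_interior (capacity_facet C (c l) (b l))"
  obtains \<delta> where "0 < \<delta>" "\<And>w. c l \<bullet> w = 0 \<Longrightarrow> norm w \<le> \<delta> \<Longrightarrow> r + w \<in> C"
proof -
  define F where "F = capacity_facet C (c l) (b l)"
  have C: "C = halfspace_region L c b"
    and cb: "\<And>j. j \<in> {1..L} \<Longrightarrow> 0 \<le> c j \<and> norm (c j) = 1 \<and> 0 < b j"
    using md by (auto simp: minimal_description_def)
  obtain z where z: "0 \<le> z" "\<And>j. j \<in> {1..L} - {l} \<Longrightarrow> c j \<bullet> z \<le> b j" "b l < c l \<bullet> z"
    using minimal_description_irredundant[OF md l] by blast
  \<comment> \<open>A small positive vector \<open>p\<close> satisfies every constraint strictly.\<close>
  obtain t where t: "0 < t" "\<And>j. j \<in> {1..L} \<Longrightarrow> c j \<bullet> (t *\<^sub>R 1) < b j"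
  proof -
    have "\<forall>\<^sub>F t in at_right 0. c j \<bullet> (t *\<^sub>R (1::real^'n)) < b j" if "j \<in> {1..L}" for j
    proof (rule order_tendstoD(2))
      show "((\<lambda>t. c j \<bullet> (t *\<^sub>R (1::real^'n))) \<longlongrightarrow> c j \<bullet> (0 *\<^sub>R 1)) (at_right 0)"
        by (intro tendsto_intros)
      show "c j \<bullet> (0 *\<^sub>R (1::real^'n)) < b j" using cb[OF that] by simp
    qed
    then have "\<forall>\<^sub>F t in at_right 0. \<forall>j\<in>{1..L}. c j \<bullet> (t *\<^sub>R (1::real^'n)) < b j"
      by (intro eventually_ball_finite) auto
    then have "\<forall>\<^sub>F t in at_right (0::real). 0 < t \<and> (\<forall>j\<in>{1..L}. c j \<bullet> (t *\<^sub>R (1::real^'n)) < b j)"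
      using eventually_at_right_less by eventually_elim auto
    then show thesis
      using that eventually_happens'[OF trivial_limit_at_right_real] by blast
  qed
  define p :: "real^'n" where "p = t *\<^sub>R 1"
  have p: "0 < p $ i" for i using t by (simp add: p_def)
  have pc: "c j \<bullet> p < b j" if "j \<in> {1..L}" for j using t that by (simp add: p_def)
  define lam where "lam = (b l - c l \<bullet> p) / (c l \<bullet> z - c l \<bullet> p)"
  have lam: "0 < lam" "lam < 1" using pc[OF l] z(3) by (auto simp: lam_def field_simps)
  define y where "y = (1 - lam) *\<^sub>R p + lam *\<^sub>R z"
  have yl: "c l \<bullet> y = b l"
  proof -
    have "c l \<bullet> y = c l \<bullet> p + lam * (c l \<bullet> z - c l \<bullet> p)"
      by (simp add: y_def inner_add_right algebra_simps)
    also have "lam * (c l \<bullet> z - c l \<bullet> p) = b l - c l \<bullet> p"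
      using pc[OF l] z(3) by (simp add: lam_def)
    finally show ?thesis by simp
  qed
  have y0: "0 < y $ i" for i
    using lam p[of i] z(1) by (auto simp: y_def less_eq_vec_def intro!: add_pos_nonneg)
  have yj: "c j \<bullet> y < b j" if j: "j \<in> {1..L} - {l}" for j
  proof -
    have "(1 - lam) * (c j \<bullet> p) + lam * (c j \<bullet> z) < (1 - lam) * b j + lam * b j"
      using lam pc[of j] z(2)[OF j] j by (intro add_less_le_mono mult_strict_left_mono mult_left_mono) auto
    then show ?thesis by (simp add: y_def inner_add_right algebra_simps)
  qed
  have aff: "y + w \<in> affine hull F" if w: "c l \<bullet> w = 0" for w
  proof -
    have ev: "\<forall>\<^sub>F t in at_right (0::real). 0 < g (y + t *\<^sub>R w)"
      if "0 < g y" "continuous_on UNIV g" for g :: "real^'n \<Rightarrow> real"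
    proof (rule order_tendstoD(1))
      have "isCont (\<lambda>t. g (y + t *\<^sub>R w)) 0"
        using that(2) by (intro isCont_o2[of _ "\<lambda>t. y + t *\<^sub>R w" g] continuous_intros)
          (auto simp: continuous_on_eq_continuous_at)
      then show "((\<lambda>t. g (y + t *\<^sub>R w)) \<longlongrightarrow> g y) (at_right 0)"
        by (auto simp: isCont_def intro: filterlim_at_within_If tendsto_within_subset)
    qed (use that in auto)
    have "\<forall>\<^sub>F t in at_right (0::real). \<forall>i\<in>UNIV. 0 < (y + t *\<^sub>R w) $ i"
      by (intro eventually_ball_finite ballI ev[where g="\<lambda>x. x $ _"] y0 continuous_intros) auto
    moreover have "\<forall>\<^sub>F t in at_right (0::real). \<forall>j\<in>{1..L} - {l}. 0 < b j - c j \<bullet> (y + t *\<^sub>R w)"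
      using yj by (intro eventually_ball_finite ballI ev[where g="\<lambda>x. b _ - c _ \<bullet> x"] continuous_intros) auto
    moreover have "\<forall>\<^sub>F t in at_right (0::real). 0 < t" by (rule eventually_at_right_less)
    ultimately have "\<forall>\<^sub>F t in at_right (0::real). 0 < t \<and> y + t *\<^sub>R w \<in> F"
    proof eventually_elim
      case (elim t)
      have "0 \<le> y + t *\<^sub>R w" using elim(1) by (auto simp: less_eq_vec_def intro: less_imp_le)
      moreover have "c l \<bullet> (y + t *\<^sub>R w) = b l" using yl w by (simp add: inner_add_right)
      moreover have "c j \<bullet> (y + t *\<^sub>R w) \<le> b j" if "j \<in> {1..L}" for j
        using elim(2) that \<open>c l \<bullet> (y + t *\<^sub>R w) = b l\<close> by (cases "j = l") (auto intro: less_imp_le)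
      ultimately show ?case
        using elim(3) by (simp add: F_def capacity_facet_def C halfspace_region_def)
    qed
    then obtain t where t: "0 < t" "y + t *\<^sub>R w \<in> F"
      using eventually_happens'[OF trivial_limit_at_right_real] by blast
    have "c j \<bullet> y \<le> b j" if "j \<in> {1..L}" for j
      using yj[of j] yl that by (cases "j = l") (auto intro: less_imp_le)
    then have "y \<in> F"
      using yl y0 by (simp add: F_def capacity_facet_def C halfspace_region_def less_eq_vec_def less_imp_le)
    then have "(1 - 1 / t) *\<^sub>R y + (1 / t) *\<^sub>R (y + t *\<^sub>R w) \<in> affine hull F"
      using t(2) by (intro mem_affine[OF affine_affine_hull]) (auto intro: hull_inc)
    also have "(1 - 1 / t) *\<^sub>R y + (1 / t) *\<^sub>R (y + t *\<^sub>R w) = y + w"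
      using t(1) by (simp add: algebra_simps)
    finally show ?thesis .
  qed
  obtain e where e: "0 < e" "ball r e \<inter> affine hull F \<subseteq> F" "r \<in> F"
    using r unfolding F_def[symmetric] mem_rel_interior_ball by auto
  show thesis
  proof (rule that[of "e / 2"])
    fix w assume w: "c l \<bullet> w = 0" "norm w \<le> e / 2"
    have "r + 1 *\<^sub>R ((y + w) - y) \<in> affine hull F"
      using aff[OF w(1)] aff[of 0] e(3) by (intro mem_affine_3_minus[OF affine_affine_hull]) (auto intro: hull_inc)
    moreover have "r + w \<in> ball r e" using w e(1) by (auto simp: dist_norm)
    ultimately have "r + w \<in> F" using e(2) by auto
    then show "r + w \<in> C" by (simp add: F_def capacity_facet_def)
  qed (use e in auto)
qed

lemma maxweight_optimal_on_hull:
  assumes x: "x \<in> maxweight S v" and y: "y \<in> convex hull S"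
  shows "y \<bullet> v \<le> x \<bullet> v"
proof -
  have "S \<subseteq> {y. v \<bullet> y \<le> x \<bullet> v}"
    using x by (auto simp: maxweight_def is_arg_max_def not_less inner_commute)
  then have "convex hull S \<subseteq> {y. v \<bullet> y \<le> x \<bullet> v}"
    by (intro hull_minimal convex_halfspace_le)
  then show ?thesis using y by (auto simp: inner_commute)
qed

lemma norm_perp_sq:
  assumes "norm c = 1"
  shows "(norm (perp c v))\<^sup>2 = (norm v)\<^sup>2 - (c \<bullet> v)\<^sup>2"
proof -
  have "c \<bullet> c = 1" using assms by (simp add: norm_eq_1)
  then show ?thesis
    unfolding perp_def power2_norm_eq_inner
    by (simp add: inner_diff_left inner_diff_right inner_commute power2_eq_square algebra_simps)
qed

lemma inner_perp: "norm c = 1 \<Longrightarrow> c \<bullet> perp c v = 0"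
  by (simp add: perp_def inner_diff_right norm_eq_1)

text \<open>
  The chosen service beats the point of the disc around \<open>r\<close> that lies furthest in the direction of
  \<open>perp c v\<close>.
\<close>

lemma maxweight_drift:
  assumes c: "norm c = 1" and disc: "\<And>w. c \<bullet> w = 0 \<Longrightarrow> norm w \<le> \<delta> \<Longrightarrow> r + w \<in> convex hull S" and "0 < \<delta>"
    and x: "x \<in> maxweight S v"
  shows "v \<bullet> (r - x) \<le> - \<delta> * norm (perp c v)"
proof (cases "perp c v = 0")
  case True
  have "(r + 0) \<bullet> v \<le> x \<bullet> v"
    by (rule maxweight_optimal_on_hull[OF x disc]) (use \<open>0 < \<delta>\<close> in auto)
  then show ?thesis using True by (simp add: inner_diff_right inner_commute)
next
  case False
  define w where "w = (\<delta> / norm (perp c v)) *\<^sub>R perp c v"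
  have "(r + w) \<bullet> v \<le> x \<bullet> v"
    by (rule maxweight_optimal_on_hull[OF x disc])
      (use \<open>0 < \<delta>\<close> False c in \<open>auto simp: w_def inner_perp\<close>)
  moreover have "perp c v \<bullet> v = (norm (perp c v))\<^sup>2"
    unfolding norm_perp_sq[OF c]
    by (simp add: perp_def inner_diff_left power2_norm_eq_inner power2_eq_square[of "c \<bullet> v"])
  then have "w \<bullet> v = \<delta> * norm (perp c v)"
    using False by (simp add: w_def power2_eq_square)
  ultimately show ?thesis
    by (simp add: inner_diff_right inner_add_left inner_commute[of v])
qed

text \<open>
  A service off the facet loses \<open>(c \<bullet> v) * (b - c \<bullet> x)\<close> along \<open>c\<close> and can gain at most a multiple of
  \<open>norm (perp c v)\<close> across it, so it can be optimal only where \<open>c \<bullet> v\<close> is at most a multiple of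
  \<open>norm (perp c v)\<close>. The multiple is uniform because finitely many services leave a gap in \<open>b - c \<bullet> x\<close>. The
  common factor \<open>b - c \<bullet> x\<close> makes the inequality cover the services on the facet too.
\<close>

lemma facet_miss_bound:
  assumes c: "norm c = 1" and S: "finite S" and "0 < \<delta>"
    and rb: "c \<bullet> r = b" and Sb: "\<And>x. x \<in> S \<Longrightarrow> c \<bullet> x \<le> b"
    and drift: "\<And>v x. x \<in> maxweight S v \<Longrightarrow> v \<bullet> (r - x) \<le> - \<delta> * norm (perp c v)"
  obtains \<kappa> where "0 \<le> \<kappa>"
    "\<And>v x. x \<in> maxweight S v \<Longrightarrow> (c \<bullet> v) * (b - c \<bullet> x) \<le> \<kappa> * norm (perp c v) * (b - c \<bullet> x)"
proof -
  have "\<forall>\<^sub>F \<kappa> in at_top. \<forall>x\<in>S. c \<bullet> x < b \<longrightarrow> norm (r - x) \<le> \<kappa> * (b - c \<bullet> x)"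
    using S
  proof (intro eventually_ball_finite ballI)
    fix x assume "x \<in> S"
    show "\<forall>\<^sub>F \<kappa> in at_top. c \<bullet> x < b \<longrightarrow> norm (r - x) \<le> \<kappa> * (b - c \<bullet> x)"
      using eventually_ge_at_top[of "norm (r - x) / (b - c \<bullet> x)"]
      by eventually_elim (auto simp: field_simps)
  qed
  moreover have "\<forall>\<^sub>F \<kappa>::real in at_top. 0 \<le> \<kappa>" by (rule eventually_ge_at_top)
  ultimately have "\<forall>\<^sub>F \<kappa> in at_top. 0 \<le> \<kappa> \<and> (\<forall>x\<in>S. c \<bullet> x < b \<longrightarrow> norm (r - x) \<le> \<kappa> * (b - c \<bullet> x))"
    by eventually_elim auto
  then obtain \<kappa> where \<kappa>: "0 \<le> \<kappa>" "\<And>x. x \<in> S \<Longrightarrow> c \<bullet> x < b \<Longrightarrow> norm (r - x) \<le> \<kappa> * (b - c \<bullet> x)"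
    using eventually_happens'[OF trivial_limit_at_top_linorder] by blast
  show thesis
  proof (rule that[OF \<kappa>(1)])
    fix v x assume x: "x \<in> maxweight S v"
    then have xS: "x \<in> S" by (simp add: maxweight_def is_arg_max_def)
    show "(c \<bullet> v) * (b - c \<bullet> x) \<le> \<kappa> * norm (perp c v) * (b - c \<bullet> x)"
    proof (cases "c \<bullet> x < b")
      case True
      have "v = perp c v + (c \<bullet> v) *\<^sub>R c" by (simp add: perp_def)
      then have "v \<bullet> (r - x) = (perp c v + (c \<bullet> v) *\<^sub>R c) \<bullet> (r - x)" by simp
      also have "\<dots> = perp c v \<bullet> (r - x) + (c \<bullet> v) * (b - c \<bullet> x)"
        by (simp add: inner_add_left inner_diff_right rb right_diff_distrib)
      finally have "(c \<bullet> v) * (b - c \<bullet> x) = v \<bullet> (r - x) - perp c v \<bullet> (r - x)" by linarith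
      also have "\<dots> \<le> norm (perp c v) * norm (r - x)"
      proof -
        have "0 \<le> \<delta> * norm (perp c v)" using \<open>0 < \<delta>\<close> by simp
        then have "v \<bullet> (r - x) \<le> 0" using drift[OF x] by linarith
        then show ?thesis
          using norm_cauchy_schwarz[of "- perp c v" "r - x"]
          by (simp only: inner_minus_left norm_minus_cancel)
      qed
      also have "\<dots> \<le> norm (perp c v) * (\<kappa> * (b - c \<bullet> x))"
        by (rule mult_left_mono[OF \<kappa>(2)[OF xS True] norm_ge_zero])
      finally show ?thesis by (simp add: ac_simps)
    next
      case False
      then show ?thesis using Sb[OF xS] by simp
    qed
  qed
qed

text \<open>
  Service is wasted only at an empty queue \<open>v $ i = 0\<close>, where the component \<open>i\<close> of \<open>perp c v\<close>
  equals \<open>- (c \<bullet> v) * c $ i\<close>. Summing over \<open>i\<close> bounds \<open>(c \<bullet> v) * (c \<bullet> u)\<close>; queues with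
  \<open>c $ i = 0\<close> drop out, and the others have \<open>c $ i\<close> bounded away from zero.
\<close>

lemma unused_service_bound:
  fixes c :: "real^'n"
  assumes c0: "0 \<le> c"
  obtains \<kappa> where "0 \<le> \<kappa>"
    "\<And>v u. 0 \<le> u \<Longrightarrow> (\<And>i. u $ i * v $ i = 0) \<Longrightarrow>
      (c \<bullet> v) * (c \<bullet> u) \<le> \<kappa> * norm (perp c v) * (c \<bullet> u)"
proof -
  have "\<forall>\<^sub>F \<kappa> in at_top. \<forall>i\<in>UNIV. 0 < c $ i \<longrightarrow> 1 \<le> \<kappa> * c $ i"
  proof (intro eventually_ball_finite ballI)
    fix i
    show "\<forall>\<^sub>F \<kappa> in at_top. 0 < c $ i \<longrightarrow> 1 \<le> \<kappa> * c $ i"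
      using eventually_ge_at_top[of "1 / c $ i"] by eventually_elim (auto simp: field_simps)
  qed auto
  moreover have "\<forall>\<^sub>F \<kappa>::real in at_top. 0 \<le> \<kappa>" by (rule eventually_ge_at_top)
  ultimately have "\<forall>\<^sub>F \<kappa> in at_top. 0 \<le> \<kappa> \<and> (\<forall>i\<in>UNIV. 0 < c $ i \<longrightarrow> 1 \<le> \<kappa> * c $ i)"
    by eventually_elim auto
  then obtain \<kappa> where \<kappa>: "0 \<le> \<kappa>" "\<And>i. 0 < c $ i \<Longrightarrow> 1 \<le> \<kappa> * c $ i"
    using eventually_happens'[OF trivial_limit_at_top_linorder] by blast
  show thesis
  proof (rule that[OF \<kappa>(1)])
    fix v u :: "real^'n" assume u: "0 \<le> u" "\<And>i. u $ i * v $ i = 0"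
    have "(c \<bullet> v) * (c \<bullet> u) = (\<Sum>i\<in>UNIV. (c \<bullet> v) * c $ i * u $ i)"
      by (simp add: inner_vec_def sum_distrib_left mult.assoc)
    also have "\<dots> \<le> (\<Sum>i\<in>UNIV. norm (perp c v) * (\<kappa> * c $ i) * u $ i)"
    proof (rule sum_mono)
      fix i
      have ui: "0 \<le> u $ i" and ci: "0 \<le> c $ i" using u(1) c0 by (auto simp: less_eq_vec_def)
      show "(c \<bullet> v) * c $ i * u $ i \<le> norm (perp c v) * (\<kappa> * c $ i) * u $ i"
      proof (cases "0 < c $ i")
        case True
        have "(c \<bullet> v) * c $ i * u $ i = - (perp c v $ i) * u $ i + u $ i * v $ i"
          by (simp add: perp_def algebra_simps)
        also have "\<dots> \<le> norm (perp c v) * u $ i"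
          using component_le_norm_cart[of "perp c v" i] ui u(2)[of i]
          by (simp only: add_0_right) (intro mult_right_mono, auto)
        also have "\<dots> \<le> norm (perp c v) * (\<kappa> * c $ i) * u $ i"
          using \<kappa>(2)[OF True] ui mult_left_mono[of 1 "\<kappa> * c $ i" "norm (perp c v)"]
          by (intro mult_right_mono) auto
        finally show ?thesis .
      next
        case False
        with ci have "c $ i = 0" by simp
        then show ?thesis by simp
      qed
    qed
    also have "\<dots> = \<kappa> * norm (perp c v) * (c \<bullet> u)"
      by (simp add: inner_vec_def sum_distrib_left ac_simps)
    finally show "(c \<bullet> v) * (c \<bullet> u) \<le> \<kappa> * norm (perp c v) * (c \<bullet> u)" .
  qed
qed

section \<open>Deterministic one-step estimates\<close>

lemma exp_remainder:
  fixes x :: real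
  assumes "\<bar>x\<bar> \<le> 1"
  shows "\<bar>exp x - 1\<bar> \<le> 3 * \<bar>x\<bar>" "\<bar>exp x - 1 - x\<bar> \<le> 3 * x\<^sup>2"
    "\<bar>exp x - 1 - x - x\<^sup>2 / 2\<bar> \<le> 2 * \<bar>x\<bar> ^ 3"
proof -
  have "exp \<bar>x\<bar> \<le> exp 1" using assms by simp
  then have e3: "exp \<bar>x\<bar> \<le> 3" using exp_le by linarith
  have le: "exp \<bar>x\<bar> * y / k \<le> 3 * y / k" if "0 \<le> y" "0 < k" for y k :: real
    using mult_right_mono[OF e3 that(1)] that(2) by (simp add: divide_right_mono)
  show "\<bar>exp x - 1\<bar> \<le> 3 * \<bar>x\<bar>"
    using Taylor_exp_field[of x 0] le[of "\<bar>x\<bar>" 1] by simp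
  show "\<bar>exp x - 1 - x\<bar> \<le> 3 * x\<^sup>2"
    using Taylor_exp_field[of x 1] le[of "x\<^sup>2" 1] by (simp add: power2_eq_square diff_diff_eq)
  have "{..2::nat} = {0, 1, 2}" by auto
  then have sum: "(\<Sum>i\<le>2. x ^ i / fact i) = 1 + x + x\<^sup>2 / 2" by (simp add: fact_numeral)
  then show "\<bar>exp x - 1 - x - x\<^sup>2 / 2\<bar> \<le> 2 * \<bar>x\<bar> ^ 3"
  proof -
    have "0 \<le> \<bar>x\<bar> ^ 3" by simp
    moreover have "\<bar>exp x - 1 - x - x\<^sup>2 / 2\<bar> \<le> exp \<bar>x\<bar> * \<bar>x\<bar> ^ 3 / 2"
      using Taylor_exp_field[of x 2] sum by (simp add: diff_diff_eq numeral_3_eq_3)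
    ultimately show ?thesis using le[of "\<bar>x\<bar> ^ 3" 2] by linarith
  qed
qed

text \<open>
  Stands in for the Cauchy--Schwarz inequality: with \<open>\<eta> = sqrt \<epsilon>\<close>, if \<open>V\<close> has bounded second moment
  and the bounded rate \<open>w\<close> has mean at most \<open>\<epsilon>\<close>, both terms on the right have mean of order \<open>sqrt \<epsilon>\<close>.
\<close>

lemma weighted_young:
  fixes V w K \<eta> :: real
  assumes "0 < \<eta>" "0 \<le> w" "w \<le> K"
  shows "V * w \<le> \<eta> * V\<^sup>2 + K * w / \<eta>"
proof -
  have "0 \<le> (\<eta> * V - w)\<^sup>2 + (\<eta> * V)\<^sup>2 + w\<^sup>2" by simp
  then have "V * w * \<eta> \<le> (\<eta> * V)\<^sup>2 + w\<^sup>2" by (simp add: power2_eq_square algebra_simps)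
  also have "w\<^sup>2 \<le> K * w" using assms by (simp add: power2_eq_square mult_right_mono)
  finally have "V * w \<le> ((\<eta> * V)\<^sup>2 + K * w) / \<eta>" using assms(1) by (simp add: field_simps)
  also have "\<dots> = \<eta> * V\<^sup>2 + K * w / \<eta>" using assms(1) by (simp add: field_simps power2_eq_square)
  finally show ?thesis .
qed

text \<open>
  The second-order expansion of \<open>exp (- t * p') - exp (- t * p)\<close>, where \<open>p\<close> and \<open>p'\<close> stand for the
  projections of the queue vector on \<open>c\<close> before and after a slot, \<open>g\<close> for the arrivals minus \<open>b\<close>,
  \<open>e\<close> for the shortfall of the service and \<open>u\<close> for the unused service. The terms in \<open>e\<close> and \<open>u\<close> appear without
  an exponential factor, because \<open>p\<close> and \<open>p'\<close> are controlled by \<open>V\<close> and \<open>V'\<close> wherever \<open>e\<close> and \<open>u\<close> are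
  nonzero. All terms of the error bound are of order \<open>t\<^sup>2\<close> times a quantity of small mean.
\<close>

lemma laplace_step_estimate:
  fixes p p' g e u t K \<kappa> V V' \<eta> :: real
  assumes p: "0 \<le> p" "0 \<le> p'" and p': "p' = p + (g + e) + u"
    and t: "0 < t" "2 * K * t \<le> 1" and \<eta>: "0 < \<eta>" and \<kappa>: "0 \<le> \<kappa>"
    and g: "\<bar>g\<bar> \<le> 2 * K" "\<bar>g + e\<bar> \<le> 2 * K" and e: "0 \<le> e" "e \<le> K" and u: "0 \<le> u" "u \<le> K"
    and pe: "p * e \<le> \<kappa> * V * e" and pu: "p' * u \<le> \<kappa> * V' * u"
  shows "\<bar>exp (- t * p') - exp (- t * p) + t * u + t * e + t * (exp (- t * p) * g) - t\<^sup>2 / 2 * (exp (- t * p) * g\<^sup>2)\<bar>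
    \<le> 16 * (K * t) ^ 3 + 3 * t\<^sup>2 * K * u + 3 * t\<^sup>2 * \<kappa> * (\<eta> * V'\<^sup>2 + K * u / \<eta>)
      + t\<^sup>2 * \<kappa> * (\<eta> * V\<^sup>2 + K * e / \<eta>) + 5 / 2 * t\<^sup>2 * K * e"
proof -
  define f where "f = exp (- t * p)"
  define f' where "f' = exp (- t * p')"
  define d where "d = g + e"
  have f: "0 \<le> f" "f \<le> 1" and f': "0 \<le> f'" "f' \<le> 1" using t p by (auto simp: f_def f'_def)
  have lin: "1 - exp (- t * z) \<le> t * z" for z using exp_ge_add_one_self[of "- t * z"] by simp
  have K: "0 \<le> K" using e by linarith
  have tu: "\<bar>t * u\<bar> \<le> 1"
  proof -
    have "t * u \<le> t * K" using t u by simp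
    also have "\<dots> \<le> 1"
      using t(2) mult_nonneg_nonneg[of K t] K t(1) by (simp only: mult.commute[of t K])
    finally show ?thesis using t u by simp
  qed
  have td: "\<bar>- (t * d)\<bar> \<le> 2 * K * t" using t g(2) by (simp add: abs_mult d_def mult.commute)
  \<comment> \<open>Moving the unused service to the side of \<open>f'\<close> leaves an increment \<open>d\<close> that is not cut off at zero.\<close>
  have "f * exp (- (t * d)) = f' * exp (t * u)"
    unfolding f_def f'_def p' d_def by (simp add: exp_add[symmetric] algebra_simps)
  then have id: "f' - f = f * (exp (- (t * d)) - 1) - (exp (t * u) - 1) - (f' - 1) * (exp (t * u) - 1)"
    by (simp add: algebra_simps)
  define r1 where "r1 = f * (exp (- (t * d)) - 1 - (- (t * d)) - (- (t * d))\<^sup>2 / 2)"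
  define r2 where "r2 = exp (t * u) - 1 - t * u"
  define r3 where "r3 = (f' - 1) * (exp (t * u) - 1)"
  define r4 where "r4 = t * ((1 - f) * e)"
  define r5 where "r5 = t\<^sup>2 / 2 * (f * (2 * g + e) * e)"
  have b1: "\<bar>r1\<bar> \<le> 16 * (K * t) ^ 3"
  proof -
    have "\<bar>r1\<bar> \<le> 1 * (2 * \<bar>- (t * d)\<bar> ^ 3)"
      unfolding r1_def abs_mult using f td t by (intro mult_mono exp_remainder(3)) auto
    also have "\<dots> \<le> 2 * (2 * K * t) ^ 3"
      using td by (simp only: mult_1) (intro mult_left_mono power_mono, auto)
    finally show ?thesis by (simp add: power_mult_distrib)
  qed
  have b2: "\<bar>r2\<bar> \<le> 3 * t\<^sup>2 * K * u"
  proof -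
    have "\<bar>r2\<bar> \<le> 3 * (t * u)\<^sup>2" unfolding r2_def by (rule exp_remainder(2)[OF tu])
    also have "\<dots> = 3 * t\<^sup>2 * (u * u)" by (simp add: power2_eq_square)
    also have "\<dots> \<le> 3 * t\<^sup>2 * (K * u)" using u by (intro mult_left_mono mult_right_mono) auto
    finally show ?thesis by simp
  qed
  have b3: "\<bar>r3\<bar> \<le> 3 * t\<^sup>2 * \<kappa> * (\<eta> * V'\<^sup>2 + K * u / \<eta>)"
  proof -
    have "\<bar>f' - 1\<bar> \<le> t * p'" using lin[of p'] f' by (simp add: f'_def)
    then have "\<bar>r3\<bar> \<le> (t * p') * (3 * \<bar>t * u\<bar>)"
      unfolding r3_def abs_mult[of "f' - 1"]
      by (rule mult_mono[OF _ exp_remainder(1)[OF tu]]) (use p t in auto)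
    also have "\<dots> = 3 * t\<^sup>2 * (p' * u)" using t u by (simp add: power2_eq_square)
    also have "\<dots> \<le> 3 * t\<^sup>2 * (\<kappa> * V' * u)" using pu by (intro mult_left_mono) auto
    also have "\<dots> = 3 * t\<^sup>2 * \<kappa> * (V' * u)" by simp
    also have "\<dots> \<le> 3 * t\<^sup>2 * \<kappa> * (\<eta> * V'\<^sup>2 + K * u / \<eta>)"
      using \<kappa> u \<eta> by (intro mult_left_mono weighted_young) auto
    finally show ?thesis .
  qed
  have b4: "\<bar>r4\<bar> \<le> t\<^sup>2 * \<kappa> * (\<eta> * V\<^sup>2 + K * e / \<eta>)"
  proof -
    have "\<bar>r4\<bar> = t * ((1 - f) * e)" using t f e by (simp add: r4_def)
    also have "\<dots> \<le> t * (t * p * e)"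
      using lin[of p] t e by (intro mult_left_mono mult_right_mono) (auto simp: f_def)
    also have "\<dots> = t\<^sup>2 * (p * e)" by (simp add: power2_eq_square)
    also have "\<dots> \<le> t\<^sup>2 * (\<kappa> * V * e)" using pe by (intro mult_left_mono) auto
    also have "\<dots> = t\<^sup>2 * \<kappa> * (V * e)" by simp
    also have "\<dots> \<le> t\<^sup>2 * \<kappa> * (\<eta> * V\<^sup>2 + K * e / \<eta>)"
      using \<kappa> e \<eta> by (intro mult_left_mono weighted_young) auto
    finally show ?thesis .
  qed
  have b5: "\<bar>r5\<bar> \<le> 5 / 2 * t\<^sup>2 * K * e"
  proof -
    have "\<bar>r5\<bar> = t\<^sup>2 / 2 * (f * \<bar>2 * g + e\<bar> * e)"
      using f e by (simp add: r5_def abs_mult)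
    also have "\<dots> \<le> t\<^sup>2 / 2 * (1 * (5 * K) * e)"
      using f e g(1) K by (intro mult_left_mono mult_right_mono mult_mono) auto
    finally show ?thesis by simp
  qed
  have "f' - f + t * u + t * e + t * (f * g) - t\<^sup>2 / 2 * (f * g\<^sup>2) = r1 - r2 - r3 + r4 + r5"
    unfolding id r1_def r2_def r3_def r4_def r5_def d_def by (simp add: power2_eq_square field_simps)
  then show ?thesis
    using b1 b2 b3 b4 b5 unfolding f_def[symmetric] f'_def[symmetric] by linarith
qed

text \<open>
  The conditional increment of the fourth power of \<open>V = norm (perp c q)\<close> is at most
  \<open>2 * V\<^sup>2 * (k - 2 * \<delta> * V) + (m * V + k)\<^sup>2\<close>, whose leading term is \<open>- 4 * \<delta> * V ^ 3\<close>; it therefore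
  stays below a constant minus \<open>V\<^sup>2\<close>.
\<close>

lemma cubic_drift_bound:
  fixes \<delta> m k :: real
  assumes "0 < \<delta>" "0 \<le> m" "0 \<le> k"
  obtains C where "\<And>V. 0 \<le> V \<Longrightarrow> V\<^sup>2 + 2 * V\<^sup>2 * (k - 2 * \<delta> * V) + (m * V + k)\<^sup>2 \<le> C"
proof -
  define A where "A = 1 + 2 * k + m\<^sup>2"
  define B where "B = 2 * m * k"
  define R where "R = max 1 ((A + B + k\<^sup>2) / (4 * \<delta>))"
  have pos: "0 \<le> A" "0 \<le> B" using assms by (auto simp: A_def B_def)
  have R: "1 \<le> R" "(A + B + k\<^sup>2) \<le> 4 * \<delta> * R"
    using assms(1) by (auto simp: R_def max_def field_simps)
  have ex: "V\<^sup>2 + 2 * V\<^sup>2 * (k - 2 * \<delta> * V) + (m * V + k)\<^sup>2 = A * V\<^sup>2 + B * V + k\<^sup>2 - 4 * \<delta> * V * V\<^sup>2" for V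
    by (simp add: A_def B_def power2_eq_square algebra_simps)
  show thesis
  proof (rule that[of "A * R\<^sup>2 + B * R + k\<^sup>2"])
    fix V :: real assume V: "0 \<le> V"
    show "V\<^sup>2 + 2 * V\<^sup>2 * (k - 2 * \<delta> * V) + (m * V + k)\<^sup>2 \<le> A * R\<^sup>2 + B * R + k\<^sup>2"
    proof (cases "V \<le> R")
      case True
      have "A * V\<^sup>2 \<le> A * R\<^sup>2" "B * V \<le> B * R"
        using True V pos by (auto intro!: mult_left_mono power_mono)
      moreover have "0 \<le> 4 * \<delta> * V * V\<^sup>2" using assms(1) V by simp
      ultimately show ?thesis unfolding ex by linarith
    next
      case False
      then have V1: "1 \<le> V" "R \<le> V" using R(1) by auto
      then have VV: "V \<le> V\<^sup>2" "1 \<le> V\<^sup>2" by (auto simp: power2_eq_square mult_le_cancel_left1 one_le_power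
            intro: order_trans[OF _ mult_mono[of 1 V 1 V, simplified]])
      have "A + B + k\<^sup>2 \<le> 4 * \<delta> * V"
        using R(2) V1(2) assms(1) mult_left_mono[of R V "4 * \<delta>"] by linarith
      then have "(A + B + k\<^sup>2) * V\<^sup>2 \<le> 4 * \<delta> * V * V\<^sup>2" by (intro mult_right_mono) auto
      moreover have "B * V \<le> B * V\<^sup>2" "k\<^sup>2 * 1 \<le> k\<^sup>2 * V\<^sup>2"
        by (rule mult_left_mono; use VV pos in simp)+
      moreover have "0 \<le> A * R\<^sup>2 + B * R + k\<^sup>2" using pos R(1) by simp
      ultimately show ?thesis unfolding ex by (simp add: distrib_right)
    qed
  qed
qed

text \<open>
  Reflection at zero shortens the vector and increases its component along \<open>c\<close>. The square of that
  component can still decrease, namely if the component was negative before, but then by at most \<open>K\<^sup>2\<close>.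
  The orthogonal part is thus at most what it would be without the reflection, up to a constant.
\<close>

lemma next_queue_minus_perp_sq:
  fixes c v x y :: "real^'n"
  assumes c: "norm c = 1" "0 \<le> c" and v: "0 \<le> v" and y: "0 \<le> y" and x: "0 \<le> x" "c \<bullet> x \<le> K"
    and yx: "norm (y - x) \<le> 2 * K"
  shows "(norm (perp c (next_queue v y x)))\<^sup>2 \<le> (norm (perp c v))\<^sup>2 + 2 * (perp c v \<bullet> (y - x)) + 5 * K\<^sup>2"
proof -
  define p where "p = v + y - x"
  define n where "n = next_queue v y x"
  have cp: "0 \<le> c \<bullet> z" if "0 \<le> z" for z
    using c(2) that by (auto simp: inner_vec_def less_eq_vec_def intro!: sum_nonneg)
  have n: "n $ i = max (p $ i) 0" for i by (simp add: n_def next_queue_def p_def)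
  have np: "(norm n)\<^sup>2 \<le> (norm p)\<^sup>2"
    unfolding power2_norm_eq_inner inner_vec_def by (intro sum_mono) (auto simp: n max_def)
  have "(c \<bullet> p)\<^sup>2 \<le> (c \<bullet> n)\<^sup>2 + K\<^sup>2"
  proof (cases "0 \<le> c \<bullet> p")
    case True
    have "0 \<le> n - p" by (auto simp: less_eq_vec_def n)
    from cp[OF this] have "c \<bullet> p \<le> c \<bullet> n" by (simp add: inner_diff_right)
    with True have "(c \<bullet> p)\<^sup>2 \<le> (c \<bullet> n)\<^sup>2" by (intro power_mono)
    then show ?thesis by (simp add: add_increasing2)
  next
    case False
    have "- K \<le> c \<bullet> p" using cp[OF v] cp[OF y] x(2) by (simp add: p_def inner_add_right inner_diff_right)
    with False have "(c \<bullet> p)\<^sup>2 \<le> K\<^sup>2" by (intro abs_le_square_iff[THEN iffD1]) auto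
    then show ?thesis by (simp add: add_increasing)
  qed
  then have "(norm (perp c n))\<^sup>2 \<le> (norm (perp c p))\<^sup>2 + K\<^sup>2"
    using np unfolding norm_perp_sq[OF c(1)] by linarith
  also have "perp c p = perp c v + perp c (y - x)"
    by (simp add: perp_def p_def inner_diff_right inner_add_right algebra_simps)
  also have "(norm (perp c v + perp c (y - x)))\<^sup>2 =
      (norm (perp c v))\<^sup>2 + 2 * (perp c v \<bullet> perp c (y - x)) + (norm (perp c (y - x)))\<^sup>2"
    by (simp add: power2_norm_eq_inner inner_add_left inner_add_right inner_commute)
  also have "perp c v \<bullet> perp c (y - x) = perp c v \<bullet> (y - x)"
    using inner_perp[OF c(1), of v] by (simp add: perp_def[of c "y - x"] inner_diff_right[of "perp c v" "y - x"] inner_commute)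
  also have "(norm (perp c (y - x)))\<^sup>2 \<le> 4 * K\<^sup>2"
  proof -
    have "(norm (perp c (y - x)))\<^sup>2 \<le> (norm (y - x))\<^sup>2" by (simp add: norm_perp_sq[OF c(1)])
    also have "\<dots> \<le> (2 * K)\<^sup>2" using yx by (intro power_mono) auto
    finally show ?thesis by simp
  qed
  finally show ?thesis unfolding n_def by simp
qed

section \<open>The stationary law of service and queue\<close>

text \<open>
  The joint law of service vector and queue vector in a slot. The service comes first so that
  measurability can be checked for each of the finitely many services separately.
\<close>

definition service_queue_law ::
  "(real^'n) set \<Rightarrow> (real^'n) measure \<Rightarrow> (real^'n \<Rightarrow> (real^'n) pmf) \<Rightarrow> ((real^'n) \<times> (real^'n)) measure" where
  "service_queue_law S \<pi> tie = density (count_space S \<Otimes>\<^sub>M \<pi>) (\<lambda>(x, v). ennreal (pmf (tie v) x))"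

lemma next_queue_measurable [measurable]:
  "f \<in> borel_measurable M \<Longrightarrow> g \<in> borel_measurable M \<Longrightarrow> h \<in> borel_measurable M \<Longrightarrow>
    (\<lambda>w. next_queue (f w) (g w) (h w :: real^'n)) \<in> borel_measurable M"
  unfolding next_queue_def
  by (subst borel_measurable_euclidean_space)
    (auto simp: Basis_vec_def inner_axis intro!: borel_measurable_max borel_measurable_add borel_measurable_diff
      measurable_compose[OF _ borel_measurable_nth])

context
  fixes S :: "(real^'n) set" and \<pi> :: "(real^'n) measure" and tie :: "real^'n \<Rightarrow> (real^'n) pmf"
  assumes fin: "finite S" and \<pi>: "prob_space \<pi>" "sets \<pi> = sets borel"
    and tie: "tie_breaking S tie"
begin

lemma tie_measurable: "(\<lambda>v. ennreal (pmf (tie v) x)) \<in> borel_measurable \<pi>"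
  using tie \<pi>(2) by (auto simp: tie_breaking_def cong: measurable_cong_sets)

lemma tie_measurable_pair:
  "(\<lambda>(x, v). ennreal (pmf (tie v) x)) \<in> borel_measurable (count_space S \<Otimes>\<^sub>M \<pi>)"
  using fin tie_measurable by (intro measurable_pair_measure_countable1) (auto simp: countable_finite)

lemma tie_support: "x \<in> set_pmf (tie v) \<Longrightarrow> x \<in> S"
  using tie by (auto simp: tie_breaking_def maxweight_def is_arg_max_def)

lemma nn_integral_service_queue_law:
  assumes [measurable]: "f \<in> borel_measurable (count_space S \<Otimes>\<^sub>M \<pi>)"
  shows "(\<integral>\<^sup>+z. f z \<partial>service_queue_law S \<pi> tie) = (\<integral>\<^sup>+v. (\<Sum>x\<in>S. ennreal (pmf (tie v) x) * f (x, v)) \<partial>\<pi>)"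
proof -
  interpret prob_space \<pi> by fact
  note [measurable] = tie_measurable tie_measurable_pair
  have "(\<integral>\<^sup>+z. f z \<partial>service_queue_law S \<pi> tie) =
        (\<integral>\<^sup>+z. (case z of (x, v) \<Rightarrow> ennreal (pmf (tie v) x)) * f z \<partial>(count_space S \<Otimes>\<^sub>M \<pi>))"
    unfolding service_queue_law_def by (subst nn_integral_density) auto
  also have "\<dots> = (\<integral>\<^sup>+x. \<integral>\<^sup>+v. ennreal (pmf (tie v) x) * f (x, v) \<partial>\<pi> \<partial>count_space S)"
    by (subst nn_integral_fst[symmetric]) auto
  also have "\<dots> = (\<Sum>x\<in>S. \<integral>\<^sup>+v. ennreal (pmf (tie v) x) * f (x, v) \<partial>\<pi>)"
    using fin by (simp add: nn_integral_count_space_finite)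
  also have "\<dots> = (\<integral>\<^sup>+v. (\<Sum>x\<in>S. ennreal (pmf (tie v) x) * f (x, v)) \<partial>\<pi>)"
    by (rule nn_integral_sum[symmetric]) measurable
  finally show ?thesis .
qed

lemma sum_tie: "(\<Sum>x\<in>S. ennreal (pmf (tie v) x)) = 1"
proof -
  have "(\<Sum>x\<in>S. pmf (tie v) x) = 1"
    using fin by (intro sum_pmf_eq_1) (auto dest: tie_support)
  then show ?thesis by (simp add: sum_ennreal)
qed

lemma sets_service_queue_law [measurable_cong]:
  "sets (service_queue_law S \<pi> tie) = sets (count_space S \<Otimes>\<^sub>M borel)"
  unfolding service_queue_law_def sets_density
  by (rule sets_pair_measure_cong[OF refl \<pi>(2)])

lemma fst_service_queue_law [measurable]: "fst \<in> borel_measurable (service_queue_law S \<pi> tie)"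
proof -
  have "(\<lambda>x. x) \<in> borel_measurable (count_space S)" by simp
  from measurable_compose[OF measurable_fst this]
  have "fst \<in> borel_measurable (count_space S \<Otimes>\<^sub>M (borel :: (real^'n) measure))" .
  then show ?thesis by (simp cong: measurable_cong_sets add: sets_service_queue_law)
qed

lemma snd_service_queue_law [measurable]: "snd \<in> borel_measurable (service_queue_law S \<pi> tie)"
  by measurable

lemma prob_space_service_queue_law: "prob_space (service_queue_law S \<pi> tie)"
proof
  interpret prob_space \<pi> by fact
  have "emeasure (service_queue_law S \<pi> tie) (space (service_queue_law S \<pi> tie)) =
      (\<integral>\<^sup>+z. 1 \<partial>service_queue_law S \<pi> tie)" by simp
  also have "\<dots> = 1"
    by (subst nn_integral_service_queue_law) (auto simp: sum_tie emeasure_space_1)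
  finally show "emeasure (service_queue_law S \<pi> tie) (space (service_queue_law S \<pi> tie)) = 1" .
qed

lemma distr_snd_service_queue_law: "distr (service_queue_law S \<pi> tie) borel snd = \<pi>"
proof (rule measure_eqI)
  interpret prob_space \<pi> by fact
  note [measurable_cong] = \<pi>(2)
  fix B assume "B \<in> sets (distr (service_queue_law S \<pi> tie) borel snd)"
  then have [measurable]: "B \<in> sets borel" by simp
  have "emeasure (distr (service_queue_law S \<pi> tie) borel snd) B =
      (\<integral>\<^sup>+v. indicator B v \<partial>distr (service_queue_law S \<pi> tie) borel snd)" by simp
  also have "\<dots> = (\<integral>\<^sup>+z. indicator B (snd z) \<partial>service_queue_law S \<pi> tie)"
    by (subst nn_integral_distr) auto
  also have "\<dots> = (\<integral>\<^sup>+v. (\<Sum>x\<in>S. ennreal (pmf (tie v) x) * indicator B (snd (x, v))) \<partial>\<pi>)"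
    by (subst nn_integral_service_queue_law) auto
  also have "\<dots> = (\<integral>\<^sup>+v. indicator B v \<partial>\<pi>)"
    by (simp add: sum_distrib_right[symmetric] sum_tie)
  also have "\<dots> = emeasure \<pi> B" by (simp add: \<pi>(2))
  finally show "emeasure (distr (service_queue_law S \<pi> tie) borel snd) B = emeasure \<pi> B" .
qed (simp add: \<pi>(2))

lemma AE_service_queue_law_maxweight:
  "AE z in service_queue_law S \<pi> tie. fst z \<in> maxweight S (snd z)"
proof -
  have "AE z in service_queue_law S \<pi> tie. 0 < ennreal (pmf (tie (snd z)) (fst z))"
    unfolding service_queue_law_def
    using tie_measurable_pair by (subst AE_density) (auto simp: case_prod_beta)
  then show ?thesis
  proof eventually_elim
    case (elim z)
    then have "fst z \<in> set_pmf (tie (snd z))" by (auto simp: set_pmf_iff)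
    then show ?case using tie by (auto simp: tie_breaking_def)
  qed
qed

lemma emeasure_queue_kernel:
  assumes \<nu>: "prob_space \<nu>" "sets \<nu> = sets borel" and [measurable]: "B \<in> sets borel"
  shows "emeasure (queue_kernel \<nu> tie v) B =
    (\<Sum>x\<in>S. ennreal (pmf (tie v) x) * (\<integral>\<^sup>+y. indicator B (next_queue v y x) \<partial>\<nu>))"
proof -
  interpret \<nu>: prob_space \<nu> by fact
  interpret pair_sigma_finite \<nu> "measure_pmf (tie v)"
    by unfold_locales
  note [measurable_cong] = \<nu>(2)
  have "(\<lambda>x. x) \<in> borel_measurable (measure_pmf (tie v))" by simp
  from measurable_compose[OF measurable_snd this]
  have [measurable]: "snd \<in> borel_measurable (\<nu> \<Otimes>\<^sub>M measure_pmf (tie v))" .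
  have [measurable]: "fst \<in> borel_measurable (\<nu> \<Otimes>\<^sub>M measure_pmf (tie v))" by measurable
  have [measurable]: "(\<lambda>(y, x). next_queue v y x) \<in> borel_measurable (\<nu> \<Otimes>\<^sub>M measure_pmf (tie v))"
    unfolding case_prod_beta by measurable
  have "emeasure (queue_kernel \<nu> tie v) B = (\<integral>\<^sup>+w. indicator B w \<partial>queue_kernel \<nu> tie v)"
    by (simp add: queue_kernel_def)
  also have "\<dots> = (\<integral>\<^sup>+z. indicator B (case z of (y, x) \<Rightarrow> next_queue v y x) \<partial>(\<nu> \<Otimes>\<^sub>M measure_pmf (tie v)))"
    unfolding queue_kernel_def by (subst nn_integral_distr) auto
  also have "\<dots> = (\<integral>\<^sup>+x. \<integral>\<^sup>+y. indicator B (next_queue v y x) \<partial>\<nu> \<partial>measure_pmf (tie v))"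
    by (subst nn_integral_snd[symmetric]) auto
  also have "\<dots> = (\<Sum>x\<in>S. (\<integral>\<^sup>+y. indicator B (next_queue v y x) \<partial>\<nu>) * pmf (tie v) x)"
    using fin by (intro nn_integral_measure_pmf_support) (auto dest: tie_support)
  finally show ?thesis by (simp add: mult.commute)
qed

text \<open>
  An independent arrival turns a slot in steady state into the next slot in steady state. This is the invariance of
  \<open>\<pi>\<close> under the kernel, rewritten on a product space.
\<close>

lemma service_queue_law_stationary:
  assumes \<nu>: "prob_space \<nu>" "sets \<nu> = sets borel" and st: "steady_state_law \<nu> tie \<pi>"
  shows "distr (service_queue_law S \<pi> tie \<Otimes>\<^sub>M \<nu>) borel (\<lambda>((x, v), y). next_queue v y x) = \<pi>"
proof (rule measure_eqI)
  interpret \<nu>: prob_space \<nu> by fact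
  note [measurable_cong] = \<nu>(2)
  let ?H = "service_queue_law S \<pi> tie"
  have [measurable]: "fst \<in> borel_measurable ?H" "snd \<in> borel_measurable ?H" by measurable
  have meas [measurable]: "(\<lambda>((x, v), y). next_queue v y x) \<in> borel_measurable (?H \<Otimes>\<^sub>M \<nu>)"
    unfolding case_prod_beta by measurable
  fix B assume "B \<in> sets (distr (?H \<Otimes>\<^sub>M \<nu>) borel (\<lambda>((x, v), y). next_queue v y x))"
  then have [measurable]: "B \<in> sets borel" by simp
  have "(\<lambda>z. indicator B (next_queue (snd (fst z)) (snd z) (fst (fst z))) :: ennreal)
      \<in> borel_measurable (?H \<Otimes>\<^sub>M \<nu>)" by measurable
  from \<nu>.borel_measurable_nn_integral_fst[OF this]
  have fm: "(\<lambda>z. \<integral>\<^sup>+y. indicator B (next_queue (snd z) y (fst z)) \<partial>\<nu>) \<in> borel_measurable (count_space S \<Otimes>\<^sub>M \<pi>)"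
    using \<pi>(2) by (simp add: service_queue_law_def)
  have "emeasure (distr (?H \<Otimes>\<^sub>M \<nu>) borel (\<lambda>((x, v), y). next_queue v y x)) B =
      (\<integral>\<^sup>+w. indicator B w \<partial>distr (?H \<Otimes>\<^sub>M \<nu>) borel (\<lambda>((x, v), y). next_queue v y x))" by simp
  also have "\<dots> = (\<integral>\<^sup>+z. indicator B (next_queue (snd (fst z)) (snd z) (fst (fst z))) \<partial>(?H \<Otimes>\<^sub>M \<nu>))"
    by (subst nn_integral_distr[OF meas]) (auto simp: case_prod_beta')
  also have "\<dots> = (\<integral>\<^sup>+z. \<integral>\<^sup>+y. indicator B (next_queue (snd z) y (fst z)) \<partial>\<nu> \<partial>?H)"
    by (subst \<nu>.nn_integral_fst[symmetric]) auto
  also have "\<dots> = (\<integral>\<^sup>+v. emeasure (queue_kernel \<nu> tie v) B \<partial>\<pi>)"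
    by (subst nn_integral_service_queue_law[OF fm]) (simp add: emeasure_queue_kernel[OF \<nu>])
  also have "\<dots> = emeasure \<pi> B"
    using st by (simp add: steady_state_law_def)
  finally show "emeasure (distr (?H \<Otimes>\<^sub>M \<nu>) borel (\<lambda>((x, v), y). next_queue v y x)) B = emeasure \<pi> B" .
qed (simp add: \<pi>(2))

end

section \<open>Increments of stationary quantities\<close>

text \<open>
  Since \<open>X\<close> may have no mean, the expectations of \<open>X'\<close> and \<open>X\<close> cannot simply be subtracted. Clamping to
  \<open>{- n..n}\<close> makes both finite and equal and does not enlarge the increment, so that dominated
  convergence applies.
\<close>

lemma stationary_mean_increment:
  fixes X X' :: "'a \<Rightarrow> real"
  assumes M: "prob_space M" and [measurable]: "X \<in> borel_measurable M" "X' \<in> borel_measurable M"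
    and eq: "distr M borel X' = distr M borel X" and bd: "AE w in M. \<bar>X' w - X w\<bar> \<le> B"
  shows "(\<integral>w. X' w - X w \<partial>M) = 0"
proof -
  interpret prob_space M by fact
  define cl :: "nat \<Rightarrow> real \<Rightarrow> real" where "cl n z = max (- real n) (min (real n) z)" for n z
  have [measurable]: "cl n \<in> borel_measurable borel" for n unfolding cl_def by measurable
  have bcl: "\<bar>cl n z\<bar> \<le> real n" for n z by (auto simp: cl_def)
  have "(\<lambda>n. \<integral>w. cl n (X' w) - cl n (X w) \<partial>M) \<longlonglongrightarrow> (\<integral>w. X' w - X w \<partial>M)"
  proof (rule integral_dominated_convergence[where w="\<lambda>_. B"])
    show "AE w in M. norm (cl n (X' w) - cl n (X w)) \<le> B" for n
      using bd by eventually_elim (auto simp: cl_def)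
    show "AE w in M. (\<lambda>n. cl n (X' w) - cl n (X w)) \<longlonglongrightarrow> X' w - X w"
    proof (intro AE_I2 tendsto_diff)
      have "(\<lambda>n. cl n z) \<longlonglongrightarrow> z" for z
      proof (rule tendsto_eventually)
        obtain n0 where "\<bar>z\<bar> \<le> real n0" using real_arch_simple by blast
        then have "cl n z = z" if "n \<ge> n0" for n using that by (auto simp: cl_def)
        then show "\<forall>\<^sub>F n in sequentially. cl n z = z" unfolding eventually_sequentially by auto
      qed
      then show "(\<lambda>n. cl n (X' w)) \<longlonglongrightarrow> X' w" "(\<lambda>n. cl n (X w)) \<longlonglongrightarrow> X w" for w by auto
    qed
  qed auto
  moreover have "(\<integral>w. cl n (X' w) - cl n (X w) \<partial>M) = 0" for n
  proof -
    have int: "integrable M (\<lambda>w. cl n (X w))" "integrable M (\<lambda>w. cl n (X' w))"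
      using bcl by (auto intro!: integrable_const_bound[where B="real n"])
    have "(\<integral>w. cl n (X' w) \<partial>M) = (\<integral>z. cl n z \<partial>distr M borel X')" by (simp add: integral_distr)
    also have "\<dots> = (\<integral>w. cl n (X w) \<partial>M)" unfolding eq by (simp add: integral_distr)
    finally show ?thesis using int by simp
  qed
  ultimately have "(\<lambda>n. 0) \<longlonglongrightarrow> (\<integral>w. X' w - X w \<partial>M)" by simp
  then show ?thesis by (simp add: LIMSEQ_const_iff)
qed

text \<open>
  The Lyapunov argument for a function \<open>W\<close> that may have infinite mean: the expectation of the truncation
  \<open>min W n\<close> is finite and does not change in a step, the increment of \<open>min W n\<close> is at most that of
  \<open>W\<close> as long as \<open>W \<le> n\<close>, and it is not positive otherwise.
\<close>

lemma stationary_truncated_increment: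
  fixes W W' :: "'a \<Rightarrow> real"
  assumes M: "prob_space M" and [measurable]: "W \<in> borel_measurable M" "W' \<in> borel_measurable M"
    and eq: "distr M borel W' = distr M borel W" and pos: "\<And>w. 0 \<le> W w" "\<And>w. 0 \<le> W' w"
    and n: "0 \<le> n" and D: "integrable M D" "AE w in M. W w \<le> n \<longrightarrow> W' w - W w \<le> D w"
      "AE w in M. n < W w \<longrightarrow> 0 \<le> D w"
  shows "0 \<le> (\<integral>w. D w \<partial>M)"
proof -
  interpret prob_space M by fact
  have int: "integrable M (\<lambda>w. min (W w) n)" "integrable M (\<lambda>w. min (W' w) n)"
    using pos n by (auto intro!: integrable_const_bound[where B=n] simp: min_def)
  have "(\<integral>w. min (W' w) n \<partial>M) = (\<integral>z. min z n \<partial>distr M borel W')" by (simp add: integral_distr)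
  also have "\<dots> = (\<integral>w. min (W w) n \<partial>M)" unfolding eq by (simp add: integral_distr)
  finally have "0 = (\<integral>w. min (W' w) n - min (W w) n \<partial>M)" using int by simp
  also have "\<dots> \<le> (\<integral>w. D w \<partial>M)"
  proof (rule integral_mono_AE)
    show "AE w in M. min (W' w) n - min (W w) n \<le> D w"
      using D(2,3) by eventually_elim (auto simp: min_def)
  qed (use int D(1) in auto)
  finally show ?thesis .
qed

section \<open>One slot in steady state\<close>

text \<open>
  One slot in steady state, with load \<open>\<epsilon>\<close> below capacity: \<open>H\<close> carries the queue \<open>Q\<close> and the service
  \<open>X\<close>, and \<open>\<nu>\<close> is the law of the arrivals, which are independent of both. The constants \<open>\<delta>\<close>, \<open>K\<close>, \<open>\<kappa>\<close>
  and \<open>C\<close> collect all that is uniform in \<open>\<epsilon>\<close>: \<open>\<delta>\<close> and \<open>\<kappa>\<close> come from the geometry of the facet, \<open>K\<close> bounds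
  arrivals and services, and \<open>C\<close> is the constant of \<open>cubic_drift_bound\<close>, which becomes the bound on the
  second moment of the orthogonal component.
\<close>

locale stationary_step = H: prob_space H + \<nu>: prob_space \<nu>
  for H :: "'h measure" and \<nu> :: "(real^'n) measure" +
  fixes Q X :: "'h \<Rightarrow> real^'n" and c r :: "real^'n" and b \<delta> K \<kappa> \<epsilon> C :: real
  assumes sets_arrival [measurable_cong]: "sets \<nu> = sets borel"
    and Q_rv [measurable]: "Q \<in> borel_measurable H"
    and X_rv [measurable]: "X \<in> borel_measurable H"
    and norm_c: "norm c = 1" and c_nonneg: "0 \<le> c" and c_r: "c \<bullet> r = b"
    and delta_pos: "0 < \<delta>" and b_K: "b \<le> K" and kappa_nonneg: "0 \<le> \<kappa>" and eps_pos: "0 < \<epsilon>" "\<epsilon> < 1"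
    and Q_nonneg: "AE z in H. 0 \<le> Q z"
    and X_bounds: "AE z in H. 0 \<le> X z \<and> c \<bullet> X z \<le> b \<and> norm (X z) \<le> K"
    and drift: "AE z in H. Q z \<bullet> (r - X z) \<le> - \<delta> * norm (perp c (Q z))"
    and miss: "AE z in H. (c \<bullet> Q z) * (b - c \<bullet> X z) \<le> \<kappa> * norm (perp c (Q z)) * (b - c \<bullet> X z)"
    and unused: "\<And>v u. 0 \<le> u \<Longrightarrow> (\<And>i. u $ i * v $ i = 0) \<Longrightarrow>
      (c \<bullet> v) * (c \<bullet> u) \<le> \<kappa> * norm (perp c v) * (c \<bullet> u)"
    and arrival_bounds: "AE y in \<nu>. 0 \<le> y \<and> norm y \<le> K"
    and arrival_mean: "(\<integral>y. y \<partial>\<nu>) = r - \<epsilon> *\<^sub>R c"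
    and stationary: "distr (H \<Otimes>\<^sub>M \<nu>) borel (\<lambda>w. next_queue (Q (fst w)) (snd w) (X (fst w))) = distr H borel Q"
    and C_bound: "\<And>V. 0 \<le> V \<Longrightarrow> V\<^sup>2 + 2 * V\<^sup>2 * (5 * K\<^sup>2 - 2 * \<delta> * V) + (4 * K * V + 5 * K\<^sup>2)\<^sup>2 \<le> C"
begin

sublocale J: pair_prob_space H \<nu> ..

abbreviation "J \<equiv> H \<Otimes>\<^sub>M \<nu>"
definition q :: "'h \<times> (real^'n) \<Rightarrow> real^'n" where "q w = Q (fst w)"
definition x :: "'h \<times> (real^'n) \<Rightarrow> real^'n" where "x w = X (fst w)"
definition a :: "'h \<times> (real^'n) \<Rightarrow> real^'n" where "a w = snd w"
definition "q' w = next_queue (q w) (a w) (x w)"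
definition "U w = q' w - (q w + a w - x w)"

lemma measurable_step [measurable]:
  "q \<in> borel_measurable J" "x \<in> borel_measurable J" "a \<in> borel_measurable J"
  "q' \<in> borel_measurable J" "U \<in> borel_measurable J"
proof -
  show [measurable]: "q \<in> borel_measurable J" "x \<in> borel_measurable J" "a \<in> borel_measurable J"
    unfolding q_def[abs_def] x_def[abs_def] a_def[abs_def] by measurable
  then show [measurable]: "q' \<in> borel_measurable J" unfolding q'_def[abs_def] by measurable
  then show "U \<in> borel_measurable J" unfolding U_def[abs_def] by measurable
qed

lemma measurable_perp [measurable]: "f \<in> borel_measurable M \<Longrightarrow> (\<lambda>z. perp c (f z)) \<in> borel_measurable M"
proof -
  have "continuous_on UNIV (perp c)" unfolding perp_def by (intro continuous_intros)
  then have "perp c \<in> borel_measurable borel" by (rule borel_measurable_continuous_onI)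
  then show "f \<in> borel_measurable M \<Longrightarrow> (\<lambda>z. perp c (f z)) \<in> borel_measurable M" by simp
qed

lemma distr_fst: "distr J H fst = H" by (rule \<nu>.distr_pair_fst)

lemma AE_fst: "AE z in H. P z \<Longrightarrow> AE w in J. P (fst w)"
  by (rule AE_distrD[OF measurable_fst]) (subst distr_fst)

lemma AE_snd:
  assumes "AE y in \<nu>. P y" shows "AE w in J. P (snd w)"
proof -
  have "distr J \<nu> snd = distr (distr (\<nu> \<Otimes>\<^sub>M H) J (\<lambda>(x, y). (y, x))) \<nu> snd"
    by (subst J.distr_pair_swap) rule
  also have "\<dots> = distr (\<nu> \<Otimes>\<^sub>M H) \<nu> fst"
    by (subst distr_distr) (auto simp: comp_def case_prod_beta')
  finally have eq: "distr J \<nu> snd = \<nu>" by (simp only: H.distr_pair_fst)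
  show ?thesis by (rule AE_distrD[OF measurable_snd]) (subst eq, rule assms)
qed

lemma distr_q: "distr J borel q = distr H borel Q"
proof -
  have "distr (distr J H fst) borel Q = distr J borel (Q \<circ> fst)" by (rule distr_distr) auto
  then show ?thesis unfolding distr_fst by (simp add: q_def[abs_def] comp_def)
qed

lemma distr_q': "distr J borel q' = distr J borel q"
  using stationary unfolding distr_q by (simp add: q'_def[abs_def] q_def x_def a_def)

lemma distr_q'_compose:
  assumes [measurable]: "h \<in> borel_measurable borel"
  shows "distr J borel (\<lambda>w. h (q' w)) = distr J borel (\<lambda>w. h (q w))"
proof -
  have "distr J borel (\<lambda>w. h (q' w)) = distr (distr J borel q') borel h"
    by (subst distr_distr) (auto simp: comp_def)
  also have "\<dots> = distr J borel (\<lambda>w. h (q w))"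
    unfolding distr_q' by (subst distr_distr) (auto simp: comp_def)
  finally show ?thesis .
qed

lemma AE_bounds:
  "AE w in J. 0 \<le> q w \<and> 0 \<le> x w \<and> c \<bullet> x w \<le> b \<and> norm (x w) \<le> K \<and> 0 \<le> a w \<and> norm (a w) \<le> K \<and>
    q w \<bullet> (r - x w) \<le> - \<delta> * norm (perp c (q w)) \<and>
    (c \<bullet> q w) * (b - c \<bullet> x w) \<le> \<kappa> * norm (perp c (q w)) * (b - c \<bullet> x w)"
  using AE_fst[OF Q_nonneg] AE_fst[OF X_bounds] AE_fst[OF drift] AE_fst[OF miss] AE_snd[OF arrival_bounds]
  by eventually_elim (simp add: q_def x_def a_def)

lemma c_inner_nonneg: "0 \<le> z \<Longrightarrow> 0 \<le> c \<bullet> z"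
  using c_nonneg by (auto simp: inner_vec_def less_eq_vec_def intro!: sum_nonneg)

lemma c_inner_le_norm: "\<bar>c \<bullet> z\<bar> \<le> norm z"
  using Cauchy_Schwarz_ineq2[of c z] norm_c by simp

lemma K_nonneg: "0 \<le> K"
proof -
  have "AE w in J. 0 \<le> K" using AE_bounds
  proof eventually_elim
    case (elim w)
    then show ?case using norm_ge_zero[of "x w"] by linarith
  qed
  then show ?thesis using J.P.AE_const by blast
qed

lemma C_nonneg: "0 \<le> C"
proof -
  have "(5 * K\<^sup>2)\<^sup>2 \<le> C" using C_bound[of 0] by simp
  then show ?thesis by (rule order_trans[OF zero_le_power2])
qed

lemma U_facts: "0 \<le> U w" "U w $ i * q' w $ i = 0"
  "0 \<le> q w \<Longrightarrow> 0 \<le> a w \<Longrightarrow> 0 \<le> x w \<Longrightarrow> U w \<le> x w"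
proof -
  have U: "U w $ i = max 0 (x w $ i - (q w $ i + a w $ i))"
    and q': "q' w $ i = max (q w $ i + a w $ i - x w $ i) 0" for i
    by (auto simp: U_def q'_def next_queue_def max_def)
  show "0 \<le> U w" by (simp add: less_eq_vec_def U)
  show "U w $ i * q' w $ i = 0" by (simp add: U q' max_def)
  assume "0 \<le> q w" "0 \<le> a w" "0 \<le> x w"
  then have "0 \<le> q w $ i" "0 \<le> a w $ i" "0 \<le> x w $ i" for i by (auto simp: less_eq_vec_def)
  then have "U w $ i \<le> x w $ i" for i unfolding U by (smt (verit))
  then show "U w \<le> x w" by (simp add: less_eq_vec_def)
qed

lemma q'_nonneg: "0 \<le> q' w"
  by (auto simp: less_eq_vec_def q'_def next_queue_def)

lemma integrable_bounded:
  fixes f :: "_ \<Rightarrow> real"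
  shows "f \<in> borel_measurable J \<Longrightarrow> AE w in J. \<bar>f w\<bar> \<le> B \<Longrightarrow> integrable J f"
  by (rule integrable_bounded_prob[OF J.P.prob_space_axioms])

section \<open>State space collapse\<close>

lemma integral_independent:
  fixes f :: "'h \<Rightarrow> real" and h :: "real^'n \<Rightarrow> real"
  assumes "integrable J (\<lambda>w. f (fst w) * h (snd w))"
  shows "(\<integral>w. f (fst w) * h (snd w) \<partial>J) = (\<integral>z. f z \<partial>H) * (\<integral>y. h y \<partial>\<nu>)"
  using J.integral_fst'[OF assms] by simp

lemma c_inner_c: "c \<bullet> c = 1"
  using norm_c by (simp add: norm_eq_1)

lemma integrable_arrival: "integrable \<nu> (\<lambda>y. y)"
  by (rule \<nu>.integrable_const_bound[where B=K])
    (use arrival_bounds in \<open>auto elim!: eventually_mono\<close>)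

lemma integral_arrival_inner: "(\<integral>y. v \<bullet> y \<partial>\<nu>) = v \<bullet> (r - \<epsilon> *\<^sub>R c)"
  using integrable_arrival by (simp add: arrival_mean)

lemma integrable_arrival_inner: "integrable \<nu> (\<lambda>y. v \<bullet> y)"
  using integrable_arrival by simp

text \<open>
  Given queue and service, the mean of the increment \<open>D\<close> of the squared orthogonal component is governed by
  \<open>perp c q \<bullet> (r - x)\<close>; the correction \<open>\<epsilon> * c\<close> of the arrival mean is orthogonal to \<open>perp c q\<close>, so \<open>\<epsilon>\<close> does not
  appear.
\<close>

lemma conditional_drift:
  assumes z: "0 \<le> X z \<and> c \<bullet> X z \<le> b \<and> norm (X z) \<le> K" "0 \<le> Q z"
    "Q z \<bullet> (r - X z) \<le> - \<delta> * norm (perp c (Q z))"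
  defines "V \<equiv> norm (perp c (Q z))"
  defines "D \<equiv> (\<lambda>y. 2 * (perp c (Q z) \<bullet> (y - X z)) + 5 * K\<^sup>2)"
  shows "(\<integral>y. 2 * V\<^sup>2 * D y + (D y)\<^sup>2 \<partial>\<nu>) \<le> C - V\<^sup>2"
proof -
  have V: "0 \<le> V" by (simp add: V_def)
  have D: "D = (\<lambda>y. 2 * (perp c (Q z) \<bullet> y) + (5 * K\<^sup>2 - 2 * (perp c (Q z) \<bullet> X z)))"
    by (simp add: D_def inner_diff_right algebra_simps fun_eq_iff)
  have intD: "integrable \<nu> D" unfolding D using integrable_arrival_inner by simp
  have bD: "AE y in \<nu>. \<bar>D y\<bar> \<le> 4 * K * V + 5 * K\<^sup>2"
    using arrival_bounds
  proof eventually_elim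
    case (elim y)
    have "norm (y - X z) \<le> 2 * K" using elim z(1) norm_triangle_ineq4[of y "X z"] by linarith
    then have "\<bar>perp c (Q z) \<bullet> (y - X z)\<bar> \<le> V * (2 * K)"
      using Cauchy_Schwarz_ineq2[of "perp c (Q z)" "y - X z"] mult_left_mono[OF _ V, of "norm (y - X z)" "2 * K"]
      unfolding V_def by linarith
    then have "2 * \<bar>perp c (Q z) \<bullet> (y - X z)\<bar> \<le> 4 * K * V" by (simp add: ac_simps)
    then show ?case unfolding D_def using zero_le_power2[of K] by linarith
  qed
  have bD2: "AE y in \<nu>. (D y)\<^sup>2 \<le> (4 * K * V + 5 * K\<^sup>2)\<^sup>2"
    using bD by eventually_elim (metis abs_ge_zero power2_abs power_mono)
  have [measurable]: "D \<in> borel_measurable \<nu>" using intD by (rule borel_measurable_integrable)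
  have intD2: "integrable \<nu> (\<lambda>y. (D y)\<^sup>2)"
    by (rule \<nu>.integrable_const_bound[where B="(4 * K * V + 5 * K\<^sup>2)\<^sup>2"]) (use bD2 in auto)
  have "(\<integral>y. D y \<partial>\<nu>) = 2 * (perp c (Q z) \<bullet> (r - \<epsilon> *\<^sub>R c)) + (5 * K\<^sup>2 - 2 * (perp c (Q z) \<bullet> X z))"
    unfolding D using integrable_arrival_inner
    by (simp add: integral_arrival_inner \<nu>.prob_space del: integral_inner_right)
  also have "perp c (Q z) \<bullet> (r - \<epsilon> *\<^sub>R c) = perp c (Q z) \<bullet> r"
    using inner_perp[OF norm_c, of "Q z"] by (simp add: inner_diff_right inner_commute)
  also have "2 * (perp c (Q z) \<bullet> r) + (5 * K\<^sup>2 - 2 * (perp c (Q z) \<bullet> X z)) =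
      2 * (Q z \<bullet> (r - X z)) - 2 * ((c \<bullet> Q z) * (b - c \<bullet> X z)) + 5 * K\<^sup>2"
    by (simp add: perp_def inner_diff_left inner_diff_right c_r algebra_simps)
  also have "\<dots> \<le> 5 * K\<^sup>2 - 2 * \<delta> * V"
    using z(3) mult_nonneg_nonneg[OF c_inner_nonneg[OF z(2)], of "b - c \<bullet> X z"] z(1)
    unfolding V_def by linarith
  finally have ED: "(\<integral>y. D y \<partial>\<nu>) \<le> 5 * K\<^sup>2 - 2 * \<delta> * V" .
  have ED2: "(\<integral>y. (D y)\<^sup>2 \<partial>\<nu>) \<le> (4 * K * V + 5 * K\<^sup>2)\<^sup>2"
  proof -
    have "(\<integral>y. (D y)\<^sup>2 \<partial>\<nu>) \<le> (\<integral>y. (4 * K * V + 5 * K\<^sup>2)\<^sup>2 \<partial>\<nu>)"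
      using intD2 bD2 by (intro integral_mono_AE) auto
    then show ?thesis by (simp add: \<nu>.prob_space)
  qed
  have "(\<integral>y. 2 * V\<^sup>2 * D y + (D y)\<^sup>2 \<partial>\<nu>) = 2 * V\<^sup>2 * (\<integral>y. D y \<partial>\<nu>) + (\<integral>y. (D y)\<^sup>2 \<partial>\<nu>)"
    using intD intD2 by simp
  also have "\<dots> \<le> 2 * V\<^sup>2 * (5 * K\<^sup>2 - 2 * \<delta> * V) + (4 * K * V + 5 * K\<^sup>2)\<^sup>2"
    using ED ED2 by (intro add_mono mult_left_mono) auto
  also have "\<dots> \<le> C - V\<^sup>2" using C_bound[OF V] by linarith
  finally show ?thesis .
qed

text \<open>
  The square of the bound in \<open>next_queue_minus_perp_sq\<close>. The fourth power is the right Lyapunov function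
  because a drift \<open>- \<delta>\<close> of \<open>V\<close> becomes a drift of order \<open>- V ^ 3\<close>, which dominates \<open>- V\<^sup>2\<close> and all error
  terms.
\<close>

lemma fourth_power_step:
  "AE w in J. norm (perp c (q' w)) ^ 4 - norm (perp c (q w)) ^ 4 \<le>
    2 * (norm (perp c (q w)))\<^sup>2 * (2 * (perp c (q w) \<bullet> (a w - x w)) + 5 * K\<^sup>2)
    + (2 * (perp c (q w) \<bullet> (a w - x w)) + 5 * K\<^sup>2)\<^sup>2 \<and>
    \<bar>2 * (perp c (q w) \<bullet> (a w - x w)) + 5 * K\<^sup>2\<bar> \<le> 4 * K * norm (perp c (q w)) + 5 * K\<^sup>2"
  using AE_bounds
proof eventually_elim
  case (elim w)
  define V where "V = norm (perp c (q w))"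
  define D where "D = 2 * (perp c (q w) \<bullet> (a w - x w)) + 5 * K\<^sup>2"
  have ax: "norm (a w - x w) \<le> 2 * K" using elim norm_triangle_ineq4[of "a w" "x w"] by linarith
  have cx: "c \<bullet> x w \<le> K" using elim b_K by linarith
  have "(norm (perp c (q' w)))\<^sup>2 \<le> V\<^sup>2 + D"
    using next_queue_minus_perp_sq[OF norm_c c_nonneg _ _ _ cx ax, of "q w"] elim
    by (simp add: q'_def V_def D_def add.assoc)
  then have "((norm (perp c (q' w)))\<^sup>2)\<^sup>2 \<le> (V\<^sup>2 + D)\<^sup>2" by (intro power_mono) auto
  also have "\<dots> = V ^ 4 + (2 * V\<^sup>2 * D + D\<^sup>2)"
    by (simp add: power2_eq_square power4_eq_xxxx algebra_simps)
  finally have 1: "norm (perp c (q' w)) ^ 4 - V ^ 4 \<le> 2 * V\<^sup>2 * D + D\<^sup>2"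
    by (simp flip: power_mult)
  have "\<bar>perp c (q w) \<bullet> (a w - x w)\<bar> \<le> V * (2 * K)"
    using Cauchy_Schwarz_ineq2[of "perp c (q w)" "a w - x w"] mult_left_mono[OF ax norm_ge_zero, of "perp c (q w)"]
    unfolding V_def by linarith
  then have "2 * \<bar>perp c (q w) \<bullet> (a w - x w)\<bar> \<le> 4 * K * V" by (simp add: ac_simps)
  then have 2: "\<bar>D\<bar> \<le> 4 * K * V + 5 * K\<^sup>2"
    unfolding D_def using zero_le_power2[of K] by linarith
  from 1 2 show ?case unfolding V_def D_def by simp
qed

text \<open>
  The indicator comes from the truncation of the Lyapunov function; the bound does not depend on \<open>n\<close>.
\<close>

lemma truncated_second_moment:
  "(\<integral>z. of_bool (norm (perp c (Q z)) ^ 4 \<le> real n) * (norm (perp c (Q z)))\<^sup>2 \<partial>H) \<le> C"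
proof -
  define V where "V w = norm (perp c (q w))" for w
  define D where "D w = 2 * (perp c (q w) \<bullet> (a w - x w)) + 5 * K\<^sup>2" for w
  define G where "G w = of_bool (V w ^ 4 \<le> real n) * (2 * (V w)\<^sup>2 * D w + (D w)\<^sup>2)" for w
  have [measurable]: "V \<in> borel_measurable J" "D \<in> borel_measurable J"
    unfolding V_def[abs_def] D_def[abs_def] by measurable
  have [measurable]: "G \<in> borel_measurable J" unfolding G_def[abs_def] by measurable
  define \<beta> where "\<beta> = 4 * K * (1 + real n) + 5 * K\<^sup>2"
  have Vn: "v \<le> 1 + real n" if "v ^ 4 \<le> real n" "0 \<le> v" for v :: real
  proof (rule ccontr)
    assume "\<not> ?thesis"
    then have v: "1 < v" "real n < v" by auto
    then have "v \<le> v ^ 4" using power_increasing[of 1 4 v] by simp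
    with v that show False by linarith
  qed
  have "AE w in J. \<bar>G w\<bar> \<le> 2 * (1 + real n)\<^sup>2 * \<beta> + \<beta>\<^sup>2"
    using fourth_power_step
  proof eventually_elim
    case (elim w)
    show ?case
    proof (cases "V w ^ 4 \<le> real n")
      case True
      have V: "0 \<le> V w" "V w \<le> 1 + real n" using Vn[OF True] by (auto simp: V_def)
      have "\<bar>D w\<bar> \<le> 4 * K * V w + 5 * K\<^sup>2" using elim by (simp add: D_def V_def)
      also have "\<dots> \<le> \<beta>" unfolding \<beta>_def using V K_nonneg by (intro add_mono mult_left_mono) auto
      finally have D: "\<bar>D w\<bar> \<le> \<beta>" .
      have "\<bar>G w\<bar> \<le> 2 * (V w)\<^sup>2 * \<bar>D w\<bar> + \<bar>D w\<bar>\<^sup>2"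
        unfolding G_def using abs_triangle_ineq[of "2 * (V w)\<^sup>2 * D w" "(D w)\<^sup>2"] by (simp add: True abs_mult)
      also have "\<dots> \<le> 2 * (1 + real n)\<^sup>2 * \<beta> + \<beta>\<^sup>2"
        using V D by (intro add_mono mult_mono power_mono) auto
      finally show ?thesis .
    next
      case False
      then show ?thesis using K_nonneg by (simp add: G_def \<beta>_def)
    qed
  qed
  then have intG: "integrable J G" by (intro integrable_bounded) auto
  have eq: "distr J borel (\<lambda>w. norm (perp c (q' w)) ^ 4) = distr J borel (\<lambda>w. norm (perp c (q w)) ^ 4)"
    by (rule distr_q'_compose) measurable
  have "0 \<le> (\<integral>w. G w \<partial>J)"
  proof (rule stationary_truncated_increment[OF J.P.prob_space_axioms _ _ eq])
    show "AE w in J. norm (perp c (q w)) ^ 4 \<le> real n \<longrightarrow> norm (perp c (q' w)) ^ 4 - norm (perp c (q w)) ^ 4 \<le> G w"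
      using fourth_power_step by eventually_elim (simp add: G_def V_def D_def)
    show "AE w in J. real n < norm (perp c (q w)) ^ 4 \<longrightarrow> 0 \<le> G w"
      by (auto simp: G_def V_def)
  qed (use intG in auto)
  also have "(\<integral>w. G w \<partial>J) = (\<integral>z. (\<integral>y. G (z, y) \<partial>\<nu>) \<partial>H)"
    using intG by (rule J.integral_fst'[symmetric])
  also have "\<dots> \<le> (\<integral>z. of_bool (norm (perp c (Q z)) ^ 4 \<le> real n) * (C - (norm (perp c (Q z)))\<^sup>2) \<partial>H)"
  proof (rule integral_mono_AE)
    show "integrable H (\<lambda>z. \<integral>y. G (z, y) \<partial>\<nu>)" using intG by (rule J.integrable_fst')
    show "integrable H (\<lambda>z. of_bool (norm (perp c (Q z)) ^ 4 \<le> real n) * (C - (norm (perp c (Q z)))\<^sup>2))"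
    proof (rule H.integrable_const_bound[where B="\<bar>C\<bar> + (1 + real n)\<^sup>2"])
      show "AE z in H. norm (of_bool (norm (perp c (Q z)) ^ 4 \<le> real n) * (C - (norm (perp c (Q z)))\<^sup>2)) \<le> \<bar>C\<bar> + (1 + real n)\<^sup>2"
      proof (rule AE_I2)
        fix z
        show "norm (of_bool (norm (perp c (Q z)) ^ 4 \<le> real n) * (C - (norm (perp c (Q z)))\<^sup>2)) \<le> \<bar>C\<bar> + (1 + real n)\<^sup>2"
        proof (cases "norm (perp c (Q z)) ^ 4 \<le> real n")
          case True
          then have "(norm (perp c (Q z)))\<^sup>2 \<le> (1 + real n)\<^sup>2" by (intro power_mono Vn) auto
          moreover have "\<bar>C - (norm (perp c (Q z)))\<^sup>2\<bar> \<le> \<bar>C\<bar> + (norm (perp c (Q z)))\<^sup>2"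
            using abs_triangle_ineq4[of C "(norm (perp c (Q z)))\<^sup>2"] by simp
          ultimately show ?thesis using True by (simp only: of_bool_eq mult_1 real_norm_def)
        qed auto
      qed
    qed measurable
    show "AE z in H. (\<integral>y. G (z, y) \<partial>\<nu>) \<le> of_bool (norm (perp c (Q z)) ^ 4 \<le> real n) * (C - (norm (perp c (Q z)))\<^sup>2)"
      using X_bounds Q_nonneg drift
    proof eventually_elim
      case (elim z)
      from conditional_drift[OF elim]
      show ?case by (simp add: G_def V_def D_def q_def x_def a_def)
    qed
  qed
  finally have 0: "0 \<le> (\<integral>z. of_bool (norm (perp c (Q z)) ^ 4 \<le> real n) * (C - (norm (perp c (Q z)))\<^sup>2) \<partial>H)" .
  have int1: "integrable H (\<lambda>z. of_bool (norm (perp c (Q z)) ^ 4 \<le> real n) * (norm (perp c (Q z)))\<^sup>2)"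
  proof (rule H.integrable_const_bound[where B="(1 + real n)\<^sup>2"])
    show "AE z in H. norm (of_bool (norm (perp c (Q z)) ^ 4 \<le> real n) * (norm (perp c (Q z)))\<^sup>2) \<le> (1 + real n)\<^sup>2"
      by (rule AE_I2) (auto intro!: power_mono Vn)
  qed measurable
  have int2: "integrable H (\<lambda>z. of_bool (norm (perp c (Q z)) ^ 4 \<le> real n) :: real)"
    by (rule H.integrable_const_bound[where B=1]) auto
  have "(\<integral>z. of_bool (norm (perp c (Q z)) ^ 4 \<le> real n) * (norm (perp c (Q z)))\<^sup>2 \<partial>H) \<le>
      C * (\<integral>z. of_bool (norm (perp c (Q z)) ^ 4 \<le> real n) \<partial>H)"
    using 0 int1 int2 by (simp add: right_diff_distrib mult.commute[of _ C])
  also have "\<dots> \<le> C * (\<integral>z. 1 \<partial>H)"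
    using int2 C_nonneg by (intro mult_left_mono integral_mono) auto
  finally show ?thesis by (simp add: H.prob_space)
qed

lemma queue_perp_second_moment: "integrable H (\<lambda>z. (norm (perp c (Q z)))\<^sup>2)" "(\<integral>z. (norm (perp c (Q z)))\<^sup>2 \<partial>H) \<le> C"
proof -
  define f where "f n z = of_bool (norm (perp c (Q z)) ^ 4 \<le> real n) * (norm (perp c (Q z)))\<^sup>2" for n z
  have [measurable]: "f n \<in> borel_measurable H" for n unfolding f_def by measurable
  have "(\<lambda>n. \<integral>\<^sup>+z. ennreal (f n z) \<partial>H) \<longlonglongrightarrow> (\<integral>\<^sup>+z. ennreal ((norm (perp c (Q z)))\<^sup>2) \<partial>H)"
  proof (rule nn_integral_LIMSEQ)
    show "incseq (\<lambda>n z. ennreal (f n z))"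
      by (auto simp: incseq_def le_fun_def f_def intro!: ennreal_leI)
    show "(\<lambda>n. ennreal (f n z)) \<longlonglongrightarrow> ennreal ((norm (perp c (Q z)))\<^sup>2)" for z
    proof (rule tendsto_eventually)
      obtain n0 where "norm (perp c (Q z)) ^ 4 \<le> real n0" using real_arch_simple by blast
      then have "f n z = (norm (perp c (Q z)))\<^sup>2" if "n \<ge> n0" for n
        using that by (simp add: f_def)
      then show "\<forall>\<^sub>F n in sequentially. ennreal (f n z) = ennreal ((norm (perp c (Q z)))\<^sup>2)"
        unfolding eventually_sequentially by metis
    qed
  qed measurable
  moreover have "(\<integral>\<^sup>+z. ennreal (f n z) \<partial>H) \<le> ennreal C" for n
  proof -
    have "integrable H (f n)"
    proof (rule H.integrable_const_bound[where B="sqrt (real n)"])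
      show "AE z in H. norm (f n z) \<le> sqrt (real n)"
      proof (rule AE_I2)
        fix z
        have "(norm (perp c (Q z)))\<^sup>2 \<le> sqrt (real n)" if "norm (perp c (Q z)) ^ 4 \<le> real n"
          using that by (intro real_le_rsqrt) (simp flip: power_mult)
        then show "norm (f n z) \<le> sqrt (real n)" by (simp add: f_def)
      qed
    qed measurable
    then have "(\<integral>\<^sup>+z. ennreal (f n z) \<partial>H) = ennreal (\<integral>z. f n z \<partial>H)"
      by (rule nn_integral_eq_integral) (simp add: f_def)
    also have "\<dots> \<le> ennreal C"
      using truncated_second_moment[of n] by (intro ennreal_leI) (simp add: f_def)
    finally show ?thesis .
  qed
  ultimately have le: "(\<integral>\<^sup>+z. ennreal ((norm (perp c (Q z)))\<^sup>2) \<partial>H) \<le> ennreal C"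
    by (intro LIMSEQ_le_const2) auto
  then show int: "integrable H (\<lambda>z. (norm (perp c (Q z)))\<^sup>2)"
    by (intro integrableI_nonneg) (auto simp: le_less_trans)
  have "ennreal (\<integral>z. (norm (perp c (Q z)))\<^sup>2 \<partial>H) \<le> ennreal C"
    using le nn_integral_eq_integral[OF int] by simp
  then show "(\<integral>z. (norm (perp c (Q z)))\<^sup>2 \<partial>H) \<le> C" using C_nonneg by (simp add: ennreal_le_iff)
qed

lemma perp_second_moment:
  "integrable J (\<lambda>w. (norm (perp c (q w)))\<^sup>2)" "(\<integral>w. (norm (perp c (q w)))\<^sup>2 \<partial>J) \<le> C"
  "integrable J (\<lambda>w. (norm (perp c (q' w)))\<^sup>2)" "(\<integral>w. (norm (perp c (q' w)))\<^sup>2 \<partial>J) \<le> C"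
proof -
  define h where "h v = (norm (perp c v))\<^sup>2" for v
  have h [measurable]: "h \<in> borel_measurable borel" unfolding h_def by measurable
  have *: "integrable (distr H borel Q) h" "(\<integral>v. h v \<partial>distr H borel Q) \<le> C"
    using queue_perp_second_moment by (simp_all add: integrable_distr_eq integral_distr h_def)
  show "integrable J (\<lambda>w. (norm (perp c (q w)))\<^sup>2)" "(\<integral>w. (norm (perp c (q w)))\<^sup>2 \<partial>J) \<le> C"
    using *[folded distr_q] by (simp_all add: integrable_distr_eq integral_distr h_def)
  show "integrable J (\<lambda>w. (norm (perp c (q' w)))\<^sup>2)" "(\<integral>w. (norm (perp c (q' w)))\<^sup>2 \<partial>J) \<le> C"
    using *[folded distr_q, folded distr_q'] by (simp_all add: integrable_distr_eq integral_distr h_def)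
qed

section \<open>The Laplace transform along the facet normal\<close>

definition "missed w = b - c \<bullet> x w"
definition "idle w = c \<bullet> U w"
definition "surplus w = c \<bullet> a w - b"

lemma measurable_rates [measurable]:
  "missed \<in> borel_measurable J" "idle \<in> borel_measurable J" "surplus \<in> borel_measurable J"
  unfolding missed_def[abs_def] idle_def[abs_def] surplus_def[abs_def] by measurable

lemma c_inner_q': "c \<bullet> q' w = c \<bullet> q w + (surplus w + missed w) + idle w"
  by (simp add: missed_def idle_def surplus_def U_def inner_diff_right inner_add_right)

lemma AE_rates:
  "AE w in J. 0 \<le> missed w \<and> missed w \<le> K \<and> 0 \<le> idle w \<and> idle w \<le> K \<and>
    \<bar>surplus w\<bar> \<le> 2 * K \<and> \<bar>surplus w + missed w\<bar> \<le> 2 * K"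
  using AE_bounds
proof eventually_elim
  case (elim w)
  have x: "0 \<le> c \<bullet> x w" "c \<bullet> x w \<le> b" using elim c_inner_nonneg by auto
  have a: "0 \<le> c \<bullet> a w" "c \<bullet> a w \<le> K" using elim c_inner_nonneg c_inner_le_norm[of "a w"] by auto
  have "0 \<le> idle w" unfolding idle_def by (intro c_inner_nonneg U_facts)
  moreover have "0 \<le> c \<bullet> (x w - U w)" using elim U_facts(3)[of w] by (intro c_inner_nonneg) simp
  then have "idle w \<le> c \<bullet> x w" by (simp add: idle_def inner_diff_right)
  ultimately show ?case using x a b_K by (auto simp: missed_def surplus_def)
qed

lemma integrable_rates: "integrable J missed" "integrable J idle" "integrable J surplus"
proof -
  show "integrable J missed"
    by (rule integrable_bounded[OF measurable_rates(1), where B=K]) (rule eventually_mono[OF AE_rates], simp)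
  show "integrable J idle"
    by (rule integrable_bounded[OF measurable_rates(2), where B=K]) (rule eventually_mono[OF AE_rates], simp)
  show "integrable J surplus"
    by (rule integrable_bounded[OF measurable_rates(3), where B="2 * K"]) (rule eventually_mono[OF AE_rates], simp)
qed

lemma integral_times_surplus:
  fixes f :: "'h \<Rightarrow> real"
  assumes "integrable J (\<lambda>w. f (fst w) * surplus w)"
  shows "(\<integral>w. f (fst w) * surplus w \<partial>J) = - \<epsilon> * (\<integral>z. f z \<partial>H)"
proof -
  have "(\<integral>w. f (fst w) * surplus w \<partial>J) = (\<integral>z. f z \<partial>H) * (\<integral>y. c \<bullet> y - b \<partial>\<nu>)"
    using integral_independent[of f "\<lambda>y. c \<bullet> y - b"] assms by (simp add: surplus_def a_def)
  also have "(\<integral>y. c \<bullet> y - b \<partial>\<nu>) = - \<epsilon>"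
    using integrable_arrival_inner[of c]
    by (simp add: integral_arrival_inner \<nu>.prob_space inner_diff_right c_r c_inner_c del: integral_inner_right)
  finally show ?thesis by simp
qed

text \<open>
  The projection on \<open>c\<close> has stationary mean increment zero. Arrivals bring \<open>b - \<epsilon>\<close>, full service on the facet
  would take \<open>b\<close>, so missed and idle service together make up for \<open>\<epsilon>\<close>.
\<close>

lemma rate_balance: "(\<integral>w. missed w \<partial>J) + (\<integral>w. idle w \<partial>J) = \<epsilon>"
proof -
  have "(\<integral>w. c \<bullet> q' w - c \<bullet> q w \<partial>J) = 0"
  proof (rule stationary_mean_increment[OF J.P.prob_space_axioms])
    show "distr J borel (\<lambda>w. c \<bullet> q' w) = distr J borel (\<lambda>w. c \<bullet> q w)"
      by (rule distr_q'_compose) measurable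
    show "AE w in J. \<bar>c \<bullet> q' w - c \<bullet> q w\<bar> \<le> 3 * K"
      using AE_rates by eventually_elim (auto simp: c_inner_q')
  qed measurable
  then have "(\<integral>w. surplus w + missed w + idle w \<partial>J) = 0" by (simp add: c_inner_q' algebra_simps)
  moreover have "(\<integral>w. surplus w \<partial>J) = - \<epsilon>"
    using integral_times_surplus[of "\<lambda>_. 1"] integrable_rates by (simp add: H.prob_space)
  ultimately show ?thesis using integrable_rates by simp
qed

text \<open>
  Integrating the expansion of a single slot leaves, after division by \<open>\<theta> * \<epsilon>\<^sup>2\<close>, an equation that determines the
  Laplace transform up to an error of order \<open>sqrt \<epsilon>\<close>. The factors \<open>- \<epsilon>\<close> and the second moment of the arrivals
  split off because the arrivals are independent of the queue.
\<close>

lemma laplace_estimate: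
  assumes \<theta>: "0 < \<theta>" and small: "2 * K * (\<theta> * \<epsilon>) \<le> 1"
  shows "\<bar>1 - (\<integral>z. exp (- (\<theta> * \<epsilon>) * (c \<bullet> Q z)) \<partial>H) * (1 + \<theta> / 2 * (\<integral>y. (c \<bullet> y - b)\<^sup>2 \<partial>\<nu>))\<bar>
    \<le> sqrt \<epsilon> * (16 * K ^ 3 * \<theta>\<^sup>2 + 6 * K * \<theta> + 4 * \<kappa> * \<theta> * (C + K))"
proof -
  define t where "t = \<theta> * \<epsilon>"
  define \<eta> where "\<eta> = sqrt \<epsilon>"
  have t: "0 < t" and \<eta>: "0 < \<eta>" and \<eta>2: "\<eta> * \<eta> = \<epsilon>"
    using \<theta> eps_pos by (auto simp: t_def \<eta>_def)
  define f where "f w = exp (- t * (c \<bullet> q w))" for w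
  define f' where "f' w = exp (- t * (c \<bullet> q' w))" for w
  have fm [measurable]: "f \<in> borel_measurable J" "f' \<in> borel_measurable J"
    unfolding f_def[abs_def] f'_def[abs_def] by measurable
  have f01: "AE w in J. 0 \<le> f w \<and> f w \<le> 1 \<and> 0 \<le> f' w \<and> f' w \<le> 1"
    using AE_bounds
  proof eventually_elim
    case (elim w)
    have "0 \<le> t * (c \<bullet> q w)" "0 \<le> t * (c \<bullet> q' w)"
      using elim t c_inner_nonneg q'_nonneg by (auto intro!: mult_nonneg_nonneg)
    then show ?case by (simp add: f_def f'_def)
  qed
  have int_f: "integrable J f"
    by (rule integrable_bounded[OF fm(1), where B=1]) (rule eventually_mono[OF f01], simp)
  have int_f': "integrable J f'"
    by (rule integrable_bounded[OF fm(2), where B=1]) (rule eventually_mono[OF f01], simp)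
  have int_fg: "integrable J (\<lambda>w. f w * surplus w)"
  proof (rule integrable_bounded[where B="1 * (2 * K)"])
    show "AE w in J. \<bar>f w * surplus w\<bar> \<le> 1 * (2 * K)"
      using f01 AE_rates by eventually_elim (unfold abs_mult, rule mult_mono, auto)
  qed measurable
  have int_fg2: "integrable J (\<lambda>w. f w * (surplus w)\<^sup>2)"
  proof (rule integrable_bounded[where B="1 * (2 * K)\<^sup>2"])
    show "AE w in J. \<bar>f w * (surplus w)\<^sup>2\<bar> \<le> 1 * (2 * K)\<^sup>2"
      using f01 AE_rates
    proof eventually_elim
      case (elim w)
      then have "\<bar>surplus w\<bar>\<^sup>2 \<le> (2 * K)\<^sup>2" by (intro power_mono) auto
      with elim show ?case unfolding abs_mult power_abs by (intro mult_mono) auto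
    qed
  qed measurable
  define \<phi> where "\<phi> = (\<integral>z. exp (- t * (c \<bullet> Q z)) \<partial>H)"
  define s where "s = (\<integral>y. (c \<bullet> y - b)\<^sup>2 \<partial>\<nu>)"
  have Ef: "(\<integral>w. f w \<partial>J) = \<phi>"
  proof -
    have "(\<integral>w. f w \<partial>J) = (\<integral>v. exp (- t * (c \<bullet> v)) \<partial>distr J borel q)"
      by (simp add: integral_distr f_def)
    also have "\<dots> = \<phi>" unfolding distr_q by (simp add: integral_distr \<phi>_def)
    finally show ?thesis .
  qed
  have Ef': "(\<integral>w. f' w \<partial>J) = \<phi>"
  proof -
    have "(\<integral>w. f' w \<partial>J) = (\<integral>v. exp (- t * (c \<bullet> v)) \<partial>distr J borel q')"
      by (simp add: integral_distr f'_def)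
    also have "\<dots> = \<phi>" unfolding distr_q' distr_q by (simp add: integral_distr \<phi>_def)
    finally show ?thesis .
  qed
  have Efg: "(\<integral>w. f w * surplus w \<partial>J) = - \<epsilon> * \<phi>"
    using integral_times_surplus[of "\<lambda>z. exp (- t * (c \<bullet> Q z))"] int_fg by (simp add: f_def q_def \<phi>_def)
  have Efg2: "(\<integral>w. f w * (surplus w)\<^sup>2 \<partial>J) = \<phi> * s"
    using integral_independent[of "\<lambda>z. exp (- t * (c \<bullet> Q z))" "\<lambda>y. (c \<bullet> y - b)\<^sup>2"] int_fg2
    by (simp add: f_def q_def \<phi>_def s_def surplus_def a_def)
  define V where "V w = norm (perp c (q w))" for w
  define V' where "V' w = norm (perp c (q' w))" for w
  define m where "m = (\<integral>w. missed w \<partial>J)"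
  define i where "i = (\<integral>w. idle w \<partial>J)"
  have mi: "m + i = \<epsilon>" using rate_balance by (simp add: m_def i_def)
  have m0: "0 \<le> m" and i0: "0 \<le> i"
    unfolding m_def i_def by (rule integral_nonneg_AE, rule eventually_mono[OF AE_rates], simp)+
  define lhs where "lhs w = f' w - f w + t * idle w + t * missed w + t * (f w * surplus w)
      - t\<^sup>2 / 2 * (f w * (surplus w)\<^sup>2)" for w
  define err where "err w = 16 * (K * t) ^ 3 + 3 * t\<^sup>2 * K * idle w + 3 * t\<^sup>2 * \<kappa> * (\<eta> * (V' w)\<^sup>2 + K * idle w / \<eta>)
      + t\<^sup>2 * \<kappa> * (\<eta> * (V w)\<^sup>2 + K * missed w / \<eta>) + 5 / 2 * t\<^sup>2 * K * missed w" for w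
  have "AE w in J. \<bar>lhs w\<bar> \<le> err w"
    using AE_bounds AE_rates
  proof eventually_elim
    case (elim w)
    show ?case
      unfolding lhs_def err_def f_def f'_def
    proof (rule laplace_step_estimate[OF _ _ c_inner_q' t _ \<eta> kappa_nonneg])
      show "c \<bullet> q w * missed w \<le> \<kappa> * V w * missed w" using elim by (simp add: missed_def V_def)
      show "c \<bullet> q' w * idle w \<le> \<kappa> * V' w * idle w"
        unfolding idle_def V'_def by (intro unused U_facts)
      show "2 * K * t \<le> 1" using small by (simp add: t_def)
    qed (use elim c_inner_nonneg q'_nonneg in auto)
  qed
  moreover have int_lhs: "integrable J lhs"
    unfolding lhs_def[abs_def] using int_f int_f' int_fg int_fg2 integrable_rates by simp
  moreover have int_err: "integrable J err"
    unfolding err_def[abs_def] V_def V'_def using integrable_rates perp_second_moment by simp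
  ultimately have "\<bar>\<integral>w. lhs w \<partial>J\<bar> \<le> (\<integral>w. err w \<partial>J)"
    using integral_diff_bound[of J lhs "\<lambda>_. 0" err] by simp
  also have "(\<integral>w. lhs w \<partial>J) = t * \<epsilon> - t * \<epsilon> * \<phi> - t\<^sup>2 / 2 * (\<phi> * s)"
  proof -
    have "(\<integral>w. lhs w \<partial>J) = \<phi> - \<phi> + t * i + t * m + t * (- \<epsilon> * \<phi>) - t\<^sup>2 / 2 * (\<phi> * s)"
      unfolding lhs_def[abs_def] using int_f int_f' int_fg int_fg2 integrable_rates
      by (simp add: Ef Ef' Efg Efg2 m_def i_def)
    then show ?thesis unfolding mi[symmetric] by (simp add: algebra_simps)
  qed
  also have "(\<integral>w. err w \<partial>J) = 16 * (K * t) ^ 3 + 3 * t\<^sup>2 * K * i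
      + 3 * t\<^sup>2 * \<kappa> * (\<eta> * (\<integral>w. (V' w)\<^sup>2 \<partial>J) + K * i / \<eta>)
      + t\<^sup>2 * \<kappa> * (\<eta> * (\<integral>w. (V w)\<^sup>2 \<partial>J) + K * m / \<eta>) + 5 / 2 * t\<^sup>2 * K * m"
    unfolding err_def[abs_def] V_def V'_def using integrable_rates perp_second_moment
    by (simp add: m_def i_def J.P.prob_space)
  also have "\<dots> \<le> 16 * (K * t) ^ 3 + 3 * t\<^sup>2 * K * \<epsilon>
      + 3 * t\<^sup>2 * \<kappa> * (\<eta> * C + K * \<epsilon> / \<eta>) + t\<^sup>2 * \<kappa> * (\<eta> * C + K * \<epsilon> / \<eta>) + 5 / 2 * t\<^sup>2 * K * \<epsilon>"
    using perp_second_moment mi m0 i0 K_nonneg kappa_nonneg \<eta>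
    by (intro add_mono mult_left_mono divide_right_mono order_refl) (auto simp: V_def V'_def)
  also have "\<dots> = t * \<epsilon> * (16 * K ^ 3 * \<theta>\<^sup>2 * \<epsilon> + 11 / 2 * \<theta> * K * \<epsilon> + 4 * \<theta> * \<kappa> * (C + K) * \<eta>)"
  proof -
    have "\<epsilon> / \<eta> = \<eta>" using \<eta>2 \<eta> by (simp add: field_simps)
    then have "K * \<epsilon> / \<eta> = K * \<eta>" by (metis times_divide_eq_right)
    then show ?thesis unfolding t_def
      by (simp add: power2_eq_square power3_eq_cube algebra_simps)
  qed
  also have "\<dots> \<le> t * \<epsilon> * (\<eta> * (16 * K ^ 3 * \<theta>\<^sup>2 + 6 * K * \<theta> + 4 * \<kappa> * \<theta> * (C + K)))"
  proof -
    have "\<epsilon> \<le> \<eta>" using eps_pos \<eta>2 \<eta> by (simp add: \<eta>_def real_le_rsqrt power2_eq_square mult_le_cancel_left1)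
    then have "16 * K ^ 3 * \<theta>\<^sup>2 * \<epsilon> \<le> 16 * K ^ 3 * \<theta>\<^sup>2 * \<eta>" "11 / 2 * \<theta> * K * \<epsilon> \<le> 6 * \<theta> * K * \<eta>"
      using K_nonneg \<theta> eps_pos by (auto intro!: mult_mono)
    then show ?thesis using t eps_pos by (intro mult_left_mono) (simp_all add: algebra_simps)
  qed
  finally have "\<bar>t * \<epsilon> - t * \<epsilon> * \<phi> - t\<^sup>2 / 2 * (\<phi> * s)\<bar> \<le>
      t * \<epsilon> * (\<eta> * (16 * K ^ 3 * \<theta>\<^sup>2 + 6 * K * \<theta> + 4 * \<kappa> * \<theta> * (C + K)))" .
  also have "t * \<epsilon> - t * \<epsilon> * \<phi> - t\<^sup>2 / 2 * (\<phi> * s) = t * \<epsilon> * (1 - \<phi> * (1 + \<theta> / 2 * s))"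
    by (simp add: t_def power2_eq_square algebra_simps)
  also have "\<bar>t * \<epsilon> * (1 - \<phi> * (1 + \<theta> / 2 * s))\<bar> = t * \<epsilon> * \<bar>1 - \<phi> * (1 + \<theta> / 2 * s)\<bar>"
    using t eps_pos by (simp add: abs_mult)
  finally have "\<bar>1 - \<phi> * (1 + \<theta> / 2 * s)\<bar> \<le> \<eta> * (16 * K ^ 3 * \<theta>\<^sup>2 + 6 * K * \<theta> + 4 * \<kappa> * \<theta> * (C + K))"
    using t eps_pos by (simp add: mult_le_cancel_left_pos)
  then show ?thesis by (simp add: \<phi>_def s_def \<eta>_def t_def)
qed

end

section \<open>The heavy-traffic limit\<close>

text \<open>
  Bias--variance decomposition: the double sum is the variance of \<open>c \<bullet> Y\<close>.
\<close>

lemma second_moment_by_covariances: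
  fixes Y :: "'w \<Rightarrow> real^'n"
  assumes M: "prob_space M" and [measurable]: "Y \<in> borel_measurable M" and bd: "AE w in M. norm (Y w) \<le> K"
    and mean: "(\<integral>w. Y w \<partial>M) = \<mu>"
  shows "(\<integral>w. (c \<bullet> Y w - \<beta>)\<^sup>2 \<partial>M) =
    (\<Sum>i\<in>UNIV. \<Sum>j\<in>UNIV. c $ i * c $ j * covariance M (\<lambda>w. Y w $ i) (\<lambda>w. Y w $ j)) + (c \<bullet> \<mu> - \<beta>)\<^sup>2"
proof -
  interpret prob_space M by fact
  have int: "integrable M Y" using bd by (intro integrable_const_bound[where B=K]) auto
  have mi: "(\<integral>w. Y w $ i \<partial>M) = \<mu> $ i" for i
    using integral_bounded_linear[OF bounded_linear_vec_nth[of i] int] mean by simp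
  have Ym: "(\<lambda>w. Y w $ i) \<in> borel_measurable M" for i
    by (rule measurable_compose[OF _ borel_measurable_nth]) measurable
  have int2: "integrable M (\<lambda>w. (Y w $ i - \<mu> $ i) * (Y w $ j - \<mu> $ j))" for i j
  proof (rule integrable_const_bound[where B="(K + norm \<mu>) * (K + norm \<mu>)"])
    show "AE w in M. norm ((Y w $ i - \<mu> $ i) * (Y w $ j - \<mu> $ j)) \<le> (K + norm \<mu>) * (K + norm \<mu>)"
      using bd
    proof eventually_elim
      case (elim w)
      have "\<bar>Y w $ i - \<mu> $ i\<bar> \<le> K + norm \<mu>" for i
        using component_le_norm_cart[of "Y w" i] component_le_norm_cart[of \<mu> i] elim by linarith
      then show ?case unfolding real_norm_def abs_mult by (intro mult_mono) (auto intro: order_trans[OF abs_ge_zero])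
    qed
  qed (intro borel_measurable_times borel_measurable_diff Ym borel_measurable_const)
  have "(\<integral>w. (c \<bullet> Y w - c \<bullet> \<mu>)\<^sup>2 \<partial>M) =
      (\<integral>w. (\<Sum>i\<in>UNIV. \<Sum>j\<in>UNIV. c $ i * c $ j * ((Y w $ i - \<mu> $ i) * (Y w $ j - \<mu> $ j))) \<partial>M)"
  proof (rule Bochner_Integration.integral_cong[OF refl])
    fix w
    have "c \<bullet> Y w - c \<bullet> \<mu> = (\<Sum>i\<in>UNIV. c $ i * (Y w $ i - \<mu> $ i))"
      by (simp add: inner_vec_def sum_subtractf right_diff_distrib)
    then have "(c \<bullet> Y w - c \<bullet> \<mu>)\<^sup>2 = (\<Sum>i\<in>UNIV. \<Sum>j\<in>UNIV. c $ i * (Y w $ i - \<mu> $ i) * (c $ j * (Y w $ j - \<mu> $ j)))"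
      by (simp add: power2_eq_square sum_product)
    then show "(c \<bullet> Y w - c \<bullet> \<mu>)\<^sup>2 = (\<Sum>i\<in>UNIV. \<Sum>j\<in>UNIV. c $ i * c $ j * ((Y w $ i - \<mu> $ i) * (Y w $ j - \<mu> $ j)))"
      by (simp add: ac_simps)
  qed
  also have "\<dots> = (\<Sum>i\<in>UNIV. \<Sum>j\<in>UNIV. c $ i * c $ j * (\<integral>w. (Y w $ i - \<mu> $ i) * (Y w $ j - \<mu> $ j) \<partial>M))"
    using int2 by simp
  finally have centred: "(\<integral>w. (c \<bullet> Y w - c \<bullet> \<mu>)\<^sup>2 \<partial>M) =
      (\<Sum>i\<in>UNIV. \<Sum>j\<in>UNIV. c $ i * c $ j * covariance M (\<lambda>w. Y w $ i) (\<lambda>w. Y w $ j))"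
    by (simp add: covariance_def mi)
  define Z where "Z w = c \<bullet> Y w - c \<bullet> \<mu>" for w
  have intZ: "integrable M Z" "(\<integral>w. Z w \<partial>M) = 0"
    unfolding Z_def[abs_def] using int mean by (simp_all add: prob_space)
  have intZ2: "integrable M (\<lambda>w. (Z w)\<^sup>2)"
  proof (rule integrable_const_bound[where B="(norm c * K + \<bar>c \<bullet> \<mu>\<bar>)\<^sup>2"])
    show "AE w in M. norm ((Z w)\<^sup>2) \<le> (norm c * K + \<bar>c \<bullet> \<mu>\<bar>)\<^sup>2"
      using bd
    proof eventually_elim
      case (elim w)
      have "\<bar>c \<bullet> Y w\<bar> \<le> norm c * K"
        using Cauchy_Schwarz_ineq2[of c "Y w"] mult_left_mono[OF elim norm_ge_zero, of c] by linarith
      then have "\<bar>Z w\<bar> \<le> norm c * K + \<bar>c \<bullet> \<mu>\<bar>" unfolding Z_def by linarith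
      then have "\<bar>Z w\<bar>\<^sup>2 \<le> (norm c * K + \<bar>c \<bullet> \<mu>\<bar>)\<^sup>2" by (intro power_mono) auto
      then show ?case by simp
    qed
  qed (use intZ(1) in measurable)
  have "(\<integral>w. (c \<bullet> Y w - \<beta>)\<^sup>2 \<partial>M) = (\<integral>w. (Z w)\<^sup>2 + 2 * (c \<bullet> \<mu> - \<beta>) * Z w + (c \<bullet> \<mu> - \<beta>)\<^sup>2 \<partial>M)"
    by (simp add: Z_def power2_eq_square algebra_simps)
  also have "\<dots> = (\<integral>w. (Z w)\<^sup>2 \<partial>M) + (c \<bullet> \<mu> - \<beta>)\<^sup>2"
    using intZ intZ2 by (simp add: prob_space)
  finally show ?thesis using centred by (simp add: Z_def)
qed

theorem corollary3:
  fixes S :: "(real^'n) set"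
    and L l :: nat
    and c :: "nat \<Rightarrow> real^'n"
    and b :: "nat \<Rightarrow> real"
    and r :: "real^'n"
    and A_max :: real
    and tie :: "real^'n \<Rightarrow> (real^'n) pmf"
    and M :: "real \<Rightarrow> 'w measure"
    and q a s :: "real \<Rightarrow> nat \<Rightarrow> 'w \<Rightarrow> real^'n"
    and N :: "real \<Rightarrow> 'v measure"
    and qbar :: "real \<Rightarrow> 'v \<Rightarrow> real^'n"
    and Cov_a :: "'n \<Rightarrow> 'n \<Rightarrow> real"
  assumes "service_set S"
    and "minimal_description (convex hull S) L c b"
    and "l \<in> {1..L}"
    and "r \<in> rel_interior (capacity_facet (convex hull S) (c l) (b l))"
    and "tie_breaking S tie"
    and "\<And>\<epsilon>. \<epsilon> \<in> {0<..<1} \<Longrightarrow> maxweight_switch (M \<epsilon>) S tie A_max (q \<epsilon>) (a \<epsilon>) (s \<epsilon>)"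
    and "\<And>\<epsilon> k. \<epsilon> \<in> {0<..<1} \<Longrightarrow> 1 \<le> k \<Longrightarrow> (\<integral>\<omega>. a \<epsilon> k \<omega> \<partial>M \<epsilon>) = r - \<epsilon> *\<^sub>R c l"
    and "\<And>\<epsilon>. \<epsilon> \<in> {0<..<1} \<Longrightarrow> prob_space (N \<epsilon>)"
    and "\<And>\<epsilon>. \<epsilon> \<in> {0<..<1} \<Longrightarrow> qbar \<epsilon> \<in> borel_measurable (N \<epsilon>)"
    and "\<And>\<epsilon>. \<epsilon> \<in> {0<..<1} \<Longrightarrow>
           steady_state_law (distr (M \<epsilon>) borel (a \<epsilon> 1)) tie (distr (N \<epsilon>) borel (qbar \<epsilon>))"
    and "\<And>\<epsilon>. \<epsilon> \<in> {0<..<1} \<Longrightarrow>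
           converges_in_distribution (\<lambda>k. distr (M \<epsilon>) borel (q \<epsilon> k))
             (distr (N \<epsilon>) borel (qbar \<epsilon>)) sequentially"
    and "\<And>i j. ((\<lambda>\<epsilon>. covariance (M \<epsilon>) (\<lambda>\<omega>. a \<epsilon> 1 \<omega> $ i) (\<lambda>\<omega>. a \<epsilon> 1 \<omega> $ j))
           \<longlongrightarrow> Cov_a i j) (at_right 0)"
  shows "converges_in_distribution
           (\<lambda>\<epsilon>. distr (N \<epsilon>) borel (\<lambda>\<omega>. \<epsilon> *\<^sub>R qbar \<epsilon> \<omega>))
           (distr (exponential_distribution
                     (1 / 2 * (\<Sum>i\<in>UNIV. \<Sum>j\<in>UNIV. c l $ i * c l $ j * Cov_a i j)))
              borel (\<lambda>y. y *\<^sub>R c l))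
           (at_right 0)"
proof -
  have S: "finite S" "\<And>x. x \<in> S \<Longrightarrow> 0 \<le> x" using assms(1) by (auto simp: service_set_def)
  have region: "convex hull S = halfspace_region L c b"
    and cl: "0 \<le> c l" "norm (c l) = 1"
    using assms(2,3) by (auto simp: minimal_description_def)
  have Sb: "c l \<bullet> x \<le> b l" if "x \<in> S" for x
  proof -
    have "x \<in> convex hull S" using that by (rule hull_inc)
    then show ?thesis using assms(3) unfolding region halfspace_region_def by blast
  qed
  have rb: "c l \<bullet> r = b l"
    using assms(4) rel_interior_subset by (auto simp: capacity_facet_def)
  \<comment> \<open>All constants are chosen before \<open>\<epsilon>\<close>, because the estimates have to be uniform in it.\<close>
  obtain \<delta> where \<delta>: "0 < \<delta>" "\<And>w. c l \<bullet> w = 0 \<Longrightarrow> norm w \<le> \<delta> \<Longrightarrow> r + w \<in> convex hull S"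
    using facet_contains_disc[OF assms(2,3,4)] by blast
  have drift: "v \<bullet> (r - x) \<le> - \<delta> * norm (perp (c l) v)" if "x \<in> maxweight S v" for v x
    using maxweight_drift[OF cl(2) \<delta>(2) \<delta>(1) that] .
  obtain \<kappa>1 where \<kappa>1: "0 \<le> \<kappa>1" "\<And>v x. x \<in> maxweight S v \<Longrightarrow>
      (c l \<bullet> v) * (b l - c l \<bullet> x) \<le> \<kappa>1 * norm (perp (c l) v) * (b l - c l \<bullet> x)"
    using facet_miss_bound[OF cl(2) S(1) \<delta>(1) rb Sb drift] by blast
  obtain \<kappa>2 where \<kappa>2: "0 \<le> \<kappa>2" "\<And>v u. 0 \<le> u \<Longrightarrow> (\<And>i. u $ i * v $ i = 0) \<Longrightarrow>
      (c l \<bullet> v) * (c l \<bullet> u) \<le> \<kappa>2 * norm (perp (c l) v) * (c l \<bullet> u)"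
    using unused_service_bound[OF cl(1)] by blast
  define \<kappa> where "\<kappa> = max \<kappa>1 \<kappa>2"
  have c_pos: "0 \<le> c l \<bullet> z" if "0 \<le> z" for z
    using cl(1) that by (auto simp: inner_vec_def less_eq_vec_def intro!: sum_nonneg)
  obtain B where B: "\<And>x. x \<in> S \<Longrightarrow> norm x \<le> B"
    using finite_imp_bounded[OF S(1)] unfolding bounded_iff by blast
  define K where "K = max (max (b l) B) (real CARD('n) * A_max)"
  obtain C where C: "\<And>V. 0 \<le> V \<Longrightarrow>
      V\<^sup>2 + 2 * V\<^sup>2 * (5 * K\<^sup>2 - 2 * \<delta> * V) + (4 * \<bar>K\<bar> * V + 5 * K\<^sup>2)\<^sup>2 \<le> C"
    using cubic_drift_bound[OF \<delta>(1), of "4 * \<bar>K\<bar>" "5 * K\<^sup>2"] by (metis abs_ge_zero mult_nonneg_nonneg zero_le_numeral zero_le_power2)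
  define \<pi> where "\<pi> \<epsilon> = distr (N \<epsilon>) borel (qbar \<epsilon>)" for \<epsilon>
  define \<nu> where "\<nu> \<epsilon> = distr (M \<epsilon>) borel (a \<epsilon> 1)" for \<epsilon>
  define H where "H \<epsilon> = service_queue_law S (\<pi> \<epsilon>) tie" for \<epsilon>
  have a_facts: "prob_space (M \<epsilon>)" "a \<epsilon> 1 \<in> borel_measurable (M \<epsilon>)"
    "\<omega> \<in> space (M \<epsilon>) \<Longrightarrow> 0 \<le> a \<epsilon> 1 \<omega> \<and> norm (a \<epsilon> 1 \<omega>) \<le> K"
    if e: "\<epsilon> \<in> {0<..<1}" for \<epsilon> \<omega>
  proof -
    interpret maxweight_switch "M \<epsilon>" S tie A_max "q \<epsilon>" "a \<epsilon>" "s \<epsilon>" using assms(6)[OF e] .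
    show "prob_space (M \<epsilon>)" by (rule prob_space_axioms)
    show "a \<epsilon> 1 \<in> borel_measurable (M \<epsilon>)" using a_rv[of 1] by simp
    assume w: "\<omega> \<in> space (M \<epsilon>)"
    have i: "0 \<le> a \<epsilon> 1 \<omega> $ i" "a \<epsilon> 1 \<omega> $ i \<le> A_max" for i
      using a_bounded[of 1 \<omega> i] w by (auto simp: Nats_def)
    have "norm (a \<epsilon> 1 \<omega>) \<le> (\<Sum>i\<in>UNIV. \<bar>a \<epsilon> 1 \<omega> $ i\<bar>)" by (rule norm_le_l1_cart)
    also have "\<dots> \<le> (\<Sum>i\<in>(UNIV::'n set). A_max)" using i by (intro sum_mono) simp
    also have "\<dots> \<le> K" by (simp add: K_def)
    finally show "0 \<le> a \<epsilon> 1 \<omega> \<and> norm (a \<epsilon> 1 \<omega>) \<le> K" using i by (simp add: less_eq_vec_def)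
  qed
  have \<pi>: "prob_space (\<pi> \<epsilon>)" "sets (\<pi> \<epsilon>) = sets borel" if "\<epsilon> \<in> {0<..<1}" for \<epsilon>
    using prob_space.prob_space_distr[OF assms(8,9)[OF that]] by (auto simp: \<pi>_def)
  have \<nu>: "prob_space (\<nu> \<epsilon>)" "sets (\<nu> \<epsilon>) = sets borel" if "\<epsilon> \<in> {0<..<1}" for \<epsilon>
    using prob_space.prob_space_distr[OF a_facts(1,2)[OF that]] by (auto simp: \<nu>_def)
  have st: "steady_state_law (\<nu> \<epsilon>) tie (\<pi> \<epsilon>)" if "\<epsilon> \<in> {0<..<1}" for \<epsilon>
    using assms(10)[OF that] by (simp add: \<nu>_def \<pi>_def)
  have step: "stationary_step (H \<epsilon>) (\<nu> \<epsilon>) snd fst (c l) r (b l) \<delta> K \<kappa> \<epsilon> C" if e: "\<epsilon> \<in> {0<..<1}" for \<epsilon>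
  proof -
    note ctx = S(1) \<pi>[OF e] assms(5)
    interpret H: prob_space "H \<epsilon>" unfolding H_def using ctx by (rule prob_space_service_queue_law)
    interpret \<nu>: prob_space "\<nu> \<epsilon>" by (rule \<nu>[OF e])
    have meas [measurable]: "fst \<in> borel_measurable (H \<epsilon>)" "snd \<in> borel_measurable (H \<epsilon>)"
      unfolding H_def using fst_service_queue_law[OF ctx] snd_service_queue_law[OF ctx] by auto
    have mw: "AE z in H \<epsilon>. fst z \<in> maxweight S (snd z)"
      unfolding H_def by (rule AE_service_queue_law_maxweight[OF ctx])
    have distr_snd: "distr (H \<epsilon>) borel snd = \<pi> \<epsilon>"
      unfolding H_def by (rule distr_snd_service_queue_law[OF ctx])
    have stat: "distr (H \<epsilon> \<Otimes>\<^sub>M \<nu> \<epsilon>) borel (\<lambda>w. next_queue (snd (fst w)) (snd w) (fst (fst w))) = \<pi> \<epsilon>"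
      using service_queue_law_stationary[OF ctx \<nu>[OF e] st[OF e]] by (simp add: H_def case_prod_beta')
    note [measurable_cong] = \<nu>(2)[OF e]
    \<comment> \<open>The support of an invariant law lies in the range of the reflected step.\<close>
    have "AE v in \<pi> \<epsilon>. 0 \<le> v"
    proof -
      have [measurable]: "Measurable.pred borel (\<lambda>v::real^'n. 0 \<le> v)"
        unfolding less_eq_vec_def by measurable
      have "(\<lambda>w. next_queue (snd (fst w)) (snd w) (fst (fst w))) \<in> borel_measurable (H \<epsilon> \<Otimes>\<^sub>M \<nu> \<epsilon>)"
        by measurable
      moreover have "0 \<le> next_queue v y x" for v y x :: "real^'n"
        by (auto simp: next_queue_def less_eq_vec_def)
      ultimately show ?thesis
        unfolding stat[symmetric] by (subst AE_distr_iff) auto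
    qed
    then have Q0: "AE z in H \<epsilon>. 0 \<le> snd z"
      unfolding distr_snd[symmetric] by (rule AE_distrD[rotated]) (rule meas)
    have K: "b l \<le> K" "B \<le> K" by (auto simp: K_def)
    show ?thesis
    proof unfold_locales
      show "AE z in H \<epsilon>. 0 \<le> fst z \<and> c l \<bullet> fst z \<le> b l \<and> norm (fst z) \<le> K"
        using mw
      proof eventually_elim
        case (elim z)
        then have "fst z \<in> S" by (simp add: maxweight_def is_arg_max_def)
        then show ?case using S(2) Sb B K(2) by (meson order_trans)
      qed
      show "AE z in H \<epsilon>. snd z \<bullet> (r - fst z) \<le> - \<delta> * norm (perp (c l) (snd z))"
        using mw by eventually_elim (rule drift)
      show "AE z in H \<epsilon>. (c l \<bullet> snd z) * (b l - c l \<bullet> fst z) \<le> \<kappa> * norm (perp (c l) (snd z)) * (b l - c l \<bullet> fst z)"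
        using mw
      proof eventually_elim
        case (elim z)
        then have "fst z \<in> S" by (simp add: maxweight_def is_arg_max_def)
        then have "\<kappa>1 * norm (perp (c l) (snd z)) * (b l - c l \<bullet> fst z) \<le> \<kappa> * norm (perp (c l) (snd z)) * (b l - c l \<bullet> fst z)"
          using Sb by (intro mult_right_mono) (auto simp: \<kappa>_def)
        with \<kappa>1(2)[OF elim] show ?case by linarith
      qed
      show "(c l \<bullet> v) * (c l \<bullet> u) \<le> \<kappa> * norm (perp (c l) v) * (c l \<bullet> u)"
        if "0 \<le> u" "\<And>i. u $ i * v $ i = 0" for v u
      proof -
        have "\<kappa>2 * norm (perp (c l) v) * (c l \<bullet> u) \<le> \<kappa> * norm (perp (c l) v) * (c l \<bullet> u)"
          using c_pos[OF that(1)] by (intro mult_right_mono) (auto simp: \<kappa>_def)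
        with \<kappa>2(2)[OF that] show ?thesis by linarith
      qed
      show "AE y in \<nu> \<epsilon>. 0 \<le> y \<and> norm y \<le> K"
      proof -
        have [measurable]: "Measurable.pred borel (\<lambda>v::real^'n. 0 \<le> v)"
          unfolding less_eq_vec_def by measurable
        show ?thesis
          unfolding \<nu>_def using a_facts(2,3)[OF e] by (subst AE_distr_iff) auto
      qed
      show "(\<integral>y. y \<partial>\<nu> \<epsilon>) = r - \<epsilon> *\<^sub>R c l"
        unfolding \<nu>_def using assms(7)[OF e, of 1] a_facts(2)[OF e] by (subst integral_distr) auto
      show "distr (H \<epsilon> \<Otimes>\<^sub>M \<nu> \<epsilon>) borel (\<lambda>w. next_queue (snd (fst w)) (snd w) (fst (fst w))) = distr (H \<epsilon>) borel snd"
        unfolding stat distr_snd ..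
      show "V\<^sup>2 + 2 * V\<^sup>2 * (5 * K\<^sup>2 - 2 * \<delta> * V) + (4 * K * V + 5 * K\<^sup>2)\<^sup>2 \<le> C" if "0 \<le> V" for V
      proof -
        have "0 \<le> b l" using assms(2,3) by (auto simp: minimal_description_def intro: less_imp_le)
        then have "\<bar>K\<bar> = K" using K(1) by simp
        with C[OF that] show ?thesis by simp
      qed
    qed (use meas \<nu>(2)[OF e] cl rb \<delta>(1) K \<kappa>1(1) e Q0 in \<open>auto simp: \<kappa>_def\<close>)
  qed
  have law_H: "(\<integral>z. h (snd z) \<partial>H \<epsilon>) = (\<integral>w. h (qbar \<epsilon> w) \<partial>N \<epsilon>) \<and>
      (integrable (H \<epsilon>) (\<lambda>z. h (snd z)) \<longleftrightarrow> integrable (N \<epsilon>) (\<lambda>w. h (qbar \<epsilon> w)))"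
    if e: "\<epsilon> \<in> {0<..<1}" and [measurable]: "h \<in> borel_measurable borel" for \<epsilon> and h :: "real^'n \<Rightarrow> real"
  proof -
    interpret stationary_step "H \<epsilon>" "\<nu> \<epsilon>" snd fst "c l" r "b l" \<delta> K \<kappa> \<epsilon> C using step[OF e] .
    have "distr (H \<epsilon>) borel snd = distr (N \<epsilon>) borel (qbar \<epsilon>)"
      using distr_snd_service_queue_law[OF S(1) \<pi>[OF e] assms(5)] by (simp add: H_def \<pi>_def)
    then have "(\<integral>v. h v \<partial>distr (H \<epsilon>) borel snd) = (\<integral>v. h v \<partial>distr (N \<epsilon>) borel (qbar \<epsilon>))"
      "integrable (distr (H \<epsilon>) borel snd) h \<longleftrightarrow> integrable (distr (N \<epsilon>) borel (qbar \<epsilon>)) h"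
      by simp_all
    then show ?thesis using assms(9)[OF e] by (simp add: integral_distr integrable_distr_eq)
  qed
  have small: "\<forall>\<^sub>F \<epsilon> in at_right 0. \<epsilon> \<in> {0<..<(1::real)}"
    by (rule eventually_at_right_real) simp
  define \<sigma> where "\<sigma> = (\<Sum>i\<in>UNIV. \<Sum>j\<in>UNIV. c l $ i * c l $ j * Cov_a i j)"
  \<comment> \<open>The second moment of the arrivals about \<open>b\<close> exceeds their variance by \<open>\<epsilon>\<^sup>2\<close>, which vanishes in the limit.\<close>
  define v where "v \<epsilon> = (\<integral>y. (c l \<bullet> y - b l)\<^sup>2 \<partial>\<nu> \<epsilon>)" for \<epsilon>
  have v_cov: "v \<epsilon> = (\<Sum>i\<in>UNIV. \<Sum>j\<in>UNIV. c l $ i * c l $ j *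
      covariance (M \<epsilon>) (\<lambda>\<omega>. a \<epsilon> 1 \<omega> $ i) (\<lambda>\<omega>. a \<epsilon> 1 \<omega> $ j)) + \<epsilon>\<^sup>2"
    if e: "\<epsilon> \<in> {0<..<1}" for \<epsilon>
  proof -
    have bd: "AE w in M \<epsilon>. norm (a \<epsilon> 1 w) \<le> K" using a_facts(3)[OF e] by auto
    have "v \<epsilon> = (\<integral>w. (c l \<bullet> a \<epsilon> 1 w - b l)\<^sup>2 \<partial>M \<epsilon>)"
      unfolding v_def \<nu>_def by (rule integral_distr[OF a_facts(2)[OF e]]) measurable
    moreover have "c l \<bullet> (r - \<epsilon> *\<^sub>R c l) - b l = - \<epsilon>"
      using cl(2) by (simp add: inner_diff_right rb norm_eq_1)
    ultimately show ?thesis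
      using second_moment_by_covariances[OF a_facts(1,2)[OF e] bd assms(7)[OF e order_refl], of "c l" "b l"]
      by simp
  qed
  have v_lim: "(v \<longlongrightarrow> \<sigma>) (at_right 0)"
  proof -
    have "((\<lambda>\<epsilon>. (\<Sum>i\<in>UNIV. \<Sum>j\<in>UNIV. c l $ i * c l $ j * covariance (M \<epsilon>) (\<lambda>\<omega>. a \<epsilon> 1 \<omega> $ i) (\<lambda>\<omega>. a \<epsilon> 1 \<omega> $ j)) + \<epsilon>\<^sup>2)
        \<longlongrightarrow> \<sigma> + 0\<^sup>2) (at_right 0)"
      unfolding \<sigma>_def by (intro tendsto_intros assms(12))
    moreover have "\<forall>\<^sub>F \<epsilon> in at_right 0. (\<Sum>i\<in>UNIV. \<Sum>j\<in>UNIV. c l $ i * c l $ j * covariance (M \<epsilon>) (\<lambda>\<omega>. a \<epsilon> 1 \<omega> $ i) (\<lambda>\<omega>. a \<epsilon> 1 \<omega> $ j)) + \<epsilon>\<^sup>2 = v \<epsilon>"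
      using small by eventually_elim (simp add: v_cov)
    ultimately show ?thesis using tendsto_cong by fastforce
  qed
  have v0: "0 \<le> v \<epsilon>" for \<epsilon> unfolding v_def by simp
  have \<sigma>0: "0 \<le> \<sigma>" using tendsto_lowerbound[OF v_lim always_eventually[OF allI[OF v0]]] by simp
  define E where "E = exponential_distribution (1 / 2 * \<sigma>)"
  note E = exponential_distribution_laplace[of "1 / 2 * \<sigma>", folded E_def]
  \<comment> \<open>The scaled projection on the normal converges to the exponential law.\<close>
  define Y where "Y \<epsilon> w = \<epsilon> * (c l \<bullet> qbar \<epsilon> w)" for \<epsilon> w
  have Y_m [measurable]: "Y \<epsilon> \<in> borel_measurable (N \<epsilon>)" if "\<epsilon> \<in> {0<..<1}" for \<epsilon>
    unfolding Y_def[abs_def] using assms(9)[OF that] by measurable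
  have Y0: "AE w in N \<epsilon>. 0 \<le> Y \<epsilon> w" if e: "\<epsilon> \<in> {0<..<1}" for \<epsilon>
  proof -
    interpret stationary_step "H \<epsilon>" "\<nu> \<epsilon>" snd fst "c l" r "b l" \<delta> K \<kappa> \<epsilon> C using step[OF e] .
    have "AE z in H \<epsilon>. 0 \<le> \<epsilon> * (c l \<bullet> snd z)"
      using Q_nonneg by eventually_elim (use e c_pos in auto)
    then have "AE v in distr (H \<epsilon>) borel snd. 0 \<le> \<epsilon> * (c l \<bullet> v)"
      by (subst AE_distr_iff) auto
    also have "distr (H \<epsilon>) borel snd = distr (N \<epsilon>) borel (qbar \<epsilon>)"
      using distr_snd_service_queue_law[OF S(1) \<pi>[OF e] assms(5)] by (simp add: H_def \<pi>_def)
    finally show ?thesis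
      unfolding Y_def by (rule AE_distrD[rotated]) (rule assms(9)[OF e])
  qed
  have Y_conv: "converges_in_distribution (\<lambda>\<epsilon>. distr (N \<epsilon>) borel (Y \<epsilon>)) E (at_right 0)"
  proof (rule laplace_convergence_in_distribution)
    show "\<forall>\<^sub>F \<epsilon> in at_right 0. prob_space (distr (N \<epsilon>) borel (Y \<epsilon>)) \<and>
        sets (distr (N \<epsilon>) borel (Y \<epsilon>)) = sets borel \<and> (AE x in distr (N \<epsilon>) borel (Y \<epsilon>). 0 \<le> x)"
      using small
    proof eventually_elim
      case (elim \<epsilon>)
      then show ?case
        using Y0[OF elim] by (auto simp: AE_distr_iff intro!: prob_space.prob_space_distr assms(8) Y_m)
    qed
    show "prob_space E" "sets E = sets borel" "AE x in E. 0 \<le> x" using E \<sigma>0 by auto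
    fix k :: nat
    define \<phi> where "\<phi> \<epsilon> = (\<integral>x. exp (- (real k * x)) \<partial>distr (N \<epsilon>) borel (Y \<epsilon>))" for \<epsilon>
    define A where "A = 16 * K ^ 3 * (real k)\<^sup>2 + 6 * K * real k + 4 * \<kappa> * real k * (C + K)"
    have "(\<phi> \<longlongrightarrow> 1 / (1 + real k * (1 / 2 * \<sigma>))) (at_right 0)"
    proof (cases "k = 0")
      case True
      have "\<forall>\<^sub>F \<epsilon> in at_right 0. \<phi> \<epsilon> = 1"
        using small
      proof eventually_elim
        case (elim \<epsilon>)
        interpret prob_space "distr (N \<epsilon>) borel (Y \<epsilon>)"
          by (rule prob_space.prob_space_distr[OF assms(8)[OF elim] Y_m[OF elim]])
        show ?case using True prob_space by (simp add: \<phi>_def)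
      qed
      then show ?thesis using True by (simp add: tendsto_eventually)
    next
      case False
      have "((\<lambda>\<epsilon>. 2 * K * (real k * \<epsilon>)) \<longlongrightarrow> 2 * K * (real k * 0)) (at_right 0)"
        by (intro tendsto_intros)
      then have "\<forall>\<^sub>F \<epsilon> in at_right 0. 2 * K * (real k * \<epsilon>) < 1"
        by (rule order_tendstoD) simp
      with small have bound: "\<forall>\<^sub>F \<epsilon> in at_right 0. norm (\<phi> \<epsilon> * (1 + real k / 2 * v \<epsilon>) - 1) \<le> sqrt \<epsilon> * A"
      proof eventually_elim
        case (elim \<epsilon>)
        interpret stationary_step "H \<epsilon>" "\<nu> \<epsilon>" snd fst "c l" r "b l" \<delta> K \<kappa> \<epsilon> C using step[OF elim(1)] .
        have "\<phi> \<epsilon> = (\<integral>w. exp (- (real k * Y \<epsilon> w)) \<partial>N \<epsilon>)"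
          using Y_m[OF elim(1)] by (simp add: \<phi>_def integral_distr)
        also have "\<dots> = (\<integral>z. exp (- (real k * \<epsilon>) * (c l \<bullet> snd z)) \<partial>H \<epsilon>)"
          using law_H[OF elim(1), of "\<lambda>v. exp (- (real k * \<epsilon>) * (c l \<bullet> v))"]
          by (simp add: Y_def mult.assoc)
        finally have \<phi>: "\<phi> \<epsilon> = (\<integral>z. exp (- (real k * \<epsilon>) * (c l \<bullet> snd z)) \<partial>H \<epsilon>)" .
        have "\<bar>1 - \<phi> \<epsilon> * (1 + real k / 2 * v \<epsilon>)\<bar> \<le> sqrt \<epsilon> * A"
          unfolding \<phi> v_def A_def using False elim(2) by (intro laplace_estimate) auto
        then show ?case by (simp add: abs_minus_commute)
      qed
      have "((\<lambda>\<epsilon>. sqrt \<epsilon> * A) \<longlongrightarrow> sqrt 0 * A) (at_right 0)" by (intro tendsto_intros)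
      then have "((\<lambda>\<epsilon>. sqrt \<epsilon> * A) \<longlongrightarrow> 0) (at_right 0)" by simp
      then have "((\<lambda>\<epsilon>. \<phi> \<epsilon> * (1 + real k / 2 * v \<epsilon>) - 1) \<longlongrightarrow> 0) (at_right 0)"
        by (rule Lim_null_comparison[OF bound])
      then have "((\<lambda>\<epsilon>. \<phi> \<epsilon> * (1 + real k / 2 * v \<epsilon>)) \<longlongrightarrow> 1) (at_right 0)"
        by (simp add: LIM_zero_iff)
      moreover have pos: "1 + real k / 2 * v \<epsilon> \<noteq> 0" for \<epsilon>
        using v0[of \<epsilon>] by (metis add_pos_nonneg divide_nonneg_nonneg less_numeral_extra(1) less_numeral_extra(3) mult_nonneg_nonneg of_nat_0_le_iff zero_le_numeral)
      moreover have "1 + real k / 2 * \<sigma> \<noteq> 0"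
        using \<sigma>0 by (metis add_pos_nonneg divide_nonneg_nonneg less_numeral_extra(1) less_numeral_extra(3) mult_nonneg_nonneg of_nat_0_le_iff zero_le_numeral)
      ultimately have "((\<lambda>\<epsilon>. \<phi> \<epsilon> * (1 + real k / 2 * v \<epsilon>) / (1 + real k / 2 * v \<epsilon>)) \<longlongrightarrow> 1 / (1 + real k / 2 * \<sigma>)) (at_right 0)"
        by (intro tendsto_intros v_lim)
      then show ?thesis using pos by simp
    qed
    then show "((\<lambda>\<epsilon>. \<integral>x. exp (- (real k * x)) \<partial>distr (N \<epsilon>) borel (Y \<epsilon>)) \<longlongrightarrow> (\<integral>x. exp (- (real k * x)) \<partial>E)) (at_right 0)"
      using E(4)[of "real k"] \<sigma>0 by (simp add: \<phi>_def[abs_def])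
  qed
  \<comment> \<open>The rest of the scaled queue vector vanishes, by Chebyshev's inequality.\<close>
  have collapse: "((\<lambda>\<epsilon>. measure (N \<epsilon>) {w \<in> space (N \<epsilon>). d \<le> norm (\<epsilon> *\<^sub>R qbar \<epsilon> w - Y \<epsilon> w *\<^sub>R c l)}) \<longlongrightarrow> 0) (at_right 0)"
    if d: "0 < d" for d
  proof (rule Lim_null_comparison)
    show "\<forall>\<^sub>F \<epsilon> in at_right 0. norm (measure (N \<epsilon>) {w \<in> space (N \<epsilon>). d \<le> norm (\<epsilon> *\<^sub>R qbar \<epsilon> w - Y \<epsilon> w *\<^sub>R c l)}) \<le> \<epsilon>\<^sup>2 * C / d\<^sup>2"
      using small
    proof eventually_elim
      case (elim \<epsilon>)
      interpret stationary_step "H \<epsilon>" "\<nu> \<epsilon>" snd fst "c l" r "b l" \<delta> K \<kappa> \<epsilon> C using step[OF elim] .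
      interpret N: prob_space "N \<epsilon>" by (rule assms(8)[OF elim])
      note [measurable] = assms(9)[OF elim]
      define u where "u w = (norm (perp (c l) (qbar \<epsilon> w)))\<^sup>2" for w
      have u0: "0 \<le> u w" for w by (simp add: u_def)
      have u: "integrable (N \<epsilon>) u" "(\<integral>w. u w \<partial>N \<epsilon>) \<le> C"
        using queue_perp_second_moment law_H[OF elim, of "\<lambda>v. (norm (perp (c l) v))\<^sup>2"] by (auto simp: u_def[abs_def])
      have "{w \<in> space (N \<epsilon>). d \<le> norm (\<epsilon> *\<^sub>R qbar \<epsilon> w - Y \<epsilon> w *\<^sub>R c l)} = {w \<in> space (N \<epsilon>). \<epsilon>\<^sup>2 * u w \<ge> d\<^sup>2}"
      proof (intro Collect_cong conj_cong refl)
        fix w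
        have "\<epsilon> *\<^sub>R qbar \<epsilon> w - Y \<epsilon> w *\<^sub>R c l = \<epsilon> *\<^sub>R perp (c l) (qbar \<epsilon> w)"
          by (simp add: Y_def perp_def scaleR_diff_right)
        then have "(norm (\<epsilon> *\<^sub>R qbar \<epsilon> w - Y \<epsilon> w *\<^sub>R c l))\<^sup>2 = \<epsilon>\<^sup>2 * u w"
          by (simp add: u_def power_mult_distrib)
        then show "d \<le> norm (\<epsilon> *\<^sub>R qbar \<epsilon> w - Y \<epsilon> w *\<^sub>R c l) \<longleftrightarrow> \<epsilon>\<^sup>2 * u w \<ge> d\<^sup>2"
          using d by (metis abs_le_square_iff abs_norm_cancel abs_of_pos)
      qed
      then have "measure (N \<epsilon>) {w \<in> space (N \<epsilon>). d \<le> norm (\<epsilon> *\<^sub>R qbar \<epsilon> w - Y \<epsilon> w *\<^sub>R c l)} \<le> (\<integral>w. \<epsilon>\<^sup>2 * u w \<partial>N \<epsilon>) / d\<^sup>2"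
        using integral_Markov_inequality_measure[of "N \<epsilon>" "\<lambda>w. \<epsilon>\<^sup>2 * u w" "{}" "d\<^sup>2"] u(1) d u0 by simp
      also have "\<dots> \<le> \<epsilon>\<^sup>2 * C / d\<^sup>2" using u by (simp add: divide_right_mono mult_left_mono)
      finally show ?case by simp
    qed
    have "((\<lambda>\<epsilon>. \<epsilon>\<^sup>2 * C / d\<^sup>2) \<longlongrightarrow> 0\<^sup>2 * C / d\<^sup>2) (at_right 0)" using d by (intro tendsto_intros) auto
    then show "((\<lambda>\<epsilon>. \<epsilon>\<^sup>2 * C / d\<^sup>2) \<longlongrightarrow> 0) (at_right 0)" by simp
  qed
  have limit: "converges_in_distribution (\<lambda>\<epsilon>. distr (N \<epsilon>) borel (\<lambda>w. Y \<epsilon> w *\<^sub>R c l)) (distr E borel (\<lambda>y. y *\<^sub>R c l)) (at_right 0)"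
  proof -
    have "converges_in_distribution (\<lambda>\<epsilon>. distr (distr (N \<epsilon>) borel (Y \<epsilon>)) borel (\<lambda>y. y *\<^sub>R c l)) (distr E borel (\<lambda>y. y *\<^sub>R c l)) (at_right 0)"
      using E(2) \<sigma>0 by (intro converges_in_distribution_continuous_image[OF Y_conv] continuous_intros) auto
    moreover have "\<forall>\<^sub>F \<epsilon> in at_right 0. distr (distr (N \<epsilon>) borel (Y \<epsilon>)) borel (\<lambda>y. y *\<^sub>R c l) = distr (N \<epsilon>) borel (\<lambda>w. Y \<epsilon> w *\<^sub>R c l)"
      using small by eventually_elim (subst distr_distr, auto simp: comp_def Y_m)
    ultimately show ?thesis
      unfolding converges_in_distribution_def
      by (auto elim!: Lim_transform_eventually eventually_mono)
  qed
  have "converges_in_distribution (\<lambda>\<epsilon>. distr (N \<epsilon>) borel (\<lambda>w. \<epsilon> *\<^sub>R qbar \<epsilon> w)) (distr E borel (\<lambda>y. y *\<^sub>R c l)) (at_right 0)"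
  proof (rule converges_in_distribution_close[OF _ _ _ limit collapse])
    show "\<forall>\<^sub>F \<epsilon> in at_right 0. prob_space (N \<epsilon>) \<and> (\<lambda>w. Y \<epsilon> w *\<^sub>R c l) \<in> borel_measurable (N \<epsilon>) \<and>
        (\<lambda>w. \<epsilon> *\<^sub>R qbar \<epsilon> w) \<in> borel_measurable (N \<epsilon>)"
      using small by eventually_elim (use assms(8,9) Y_m in auto)
    have "(\<lambda>y. y *\<^sub>R c l) \<in> borel_measurable E" using E(2) \<sigma>0 by (auto cong: measurable_cong_sets)
    then show "prob_space (distr E borel (\<lambda>y. y *\<^sub>R c l))"
      using E(1) \<sigma>0 by (intro prob_space.prob_space_distr) auto
  qed auto
  then show ?thesis by (simp add: E_def \<sigma>_def)
qed

end
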